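(* Let $\alpha\in(1/2,1)$. As $s\to\infty$, the empty-system probability $\mathbb{P}(Q=0)$ satisfies $$\ln[\mathbb{P}(Q=0)]=-F\bigl(d(s)\sqrt2\bigr)\bigl(1+O(s^{\alpha-1})\bigr),$$ where $d(s)=\sqrt{s^{1-2\alpha}\gamma^2\mu_X/(2\sigma_X^2)}$ and, for $\beta>0$, $$F(\beta)=\sum_{m=1}^{\infty}\frac1m\,\frac{1}{\sqrt{2\pi}}\int_{\beta\sqrt m}^{\infty}e^{-x^2/2}\,dx.$$
   Context: Let $X$ be a non-negative integer-valued random variable with mean $\mu_X>0$, variance $\sigma_X^2$ and probability generating function $X(z)=\sum_{j\ge 0}\mathbb{P}(X=j)z^j$, whose radius of convergence is $r>1$, and such that $|X(z)|<X(r_1)$ for all $z$ with $|z|=r_1$, $z\ne r_1$, and any $r_1\in(0,r)$. For positive integers $n,s$ the demand per period $A(k)$, $k=1,2,\dots$, is a sequence of i.i.d. random variables, each distributed as $A=X_1+\dots+X_n$, the sum of $n$ i.i.d. copies of $X$. The congestion process is the Markov chain $Q_0=0$, $Q_{k+1}=\max\{Q_k+A(k)-s,0\}$. It is assumed that $0<n\mu_X<s$ and that $\mathbb{P}(A=j)>0$ for some $j>s$. Let $Q$ have the stationary distribution of this chain. The system is scaled so that, along a sequence $s\to\infty$ with $n=n(s)$, $X$ fixed and $\alpha$ fixed, $$\rho_s=\frac{n\mu_X}{s}=1-\frac{\gamma}{s^{\alpha}},$$ with $\gamma>0$ (possibly depending on $s$) bounded away from $0$ and $\infty$ as $s\to\infty$.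 *)

theory Defs
  imports "HOL-Probability.Probability" "HOL-Library.Landau_Symbols"
begin

definition pgf :: "nat pmf \<Rightarrow> 'a::{banach, real_normed_field} \<Rightarrow> 'a" where
  "pgf X z = (\<Sum>j. of_real (pmf X j) * z ^ j)"

abbreviation pmf_mean :: "nat pmf \<Rightarrow> real" where
  "pmf_mean X \<equiv> measure_pmf.expectation X real"

abbreviation pmf_var :: "nat pmf \<Rightarrow> real" where
  "pmf_var X \<equiv> measure_pmf.variance X real"

definition demand :: "nat \<Rightarrow> nat pmf \<Rightarrow> nat pmf" where
  "demand n X = map_pmf sum_list (replicate_pmf n X)"

text \<open>Transition kernel of the recursion \<open>Q\<^sub>k\<^sub>+\<^sub>1 = max {Q\<^sub>k + A(k) - s, 0}\<close>: subtraction
  on the natural numbers is truncated at zero, so the maximum is implicit.\<close>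

definition congestion_kernel :: "nat \<Rightarrow> nat \<Rightarrow> nat pmf \<Rightarrow> nat \<Rightarrow> nat pmf" where
  "congestion_kernel s n X q = map_pmf (\<lambda>a. q + a - s) (demand n X)"

definition stationary :: "('a \<Rightarrow> 'a pmf) \<Rightarrow> 'a pmf \<Rightarrow> bool" where
  "stationary K Q \<longleftrightarrow> bind_pmf Q K = Q"

text \<open>The sum starts at \<open>m = 1\<close>, hence the shift to \<open>Suc m\<close>.\<close>

definition F :: "real \<Rightarrow> real" where
  "F \<beta> = (\<Sum>m. 1 / real (Suc m) *
     (1 / sqrt (2 * pi) * (LBINT x:{\<beta> * sqrt (real (Suc m))..}. exp (- x\<^sup>2 / 2))))"

definition d :: "nat pmf \<Rightarrow> real \<Rightarrow> real \<Rightarrow> nat \<Rightarrow> real" where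
  "d X \<alpha> \<gamma> s = sqrt (real s powr (1 - 2 * \<alpha>) * \<gamma>\<^sup>2 * pmf_mean X / (2 * pmf_var X))"

end

theory Submission
  imports Defs
begin

text \<open>
  Write \<open>\<mu>\<close> and \<open>v\<close> for the mean and variance of \<open>X\<close>, and \<open>T\<^sub>k\<close> for the total demand of \<open>k\<close>
  periods, a sum of \<open>n k\<close> independent copies of \<open>X\<close>. The proof compares two series term by term.

  \<^item> Spitzer's formula gives \<open>ln P(Q = 0) = - \<Sum>\<^sub>k P(T\<^sub>k > s k) / k\<close> exactly, for every fixed \<open>s\<close>
    (\<open>stationary_empty_formula\<close>). It comes from a Wiener--Hopf factorisation carried out with
    formal power series: one variable marks time, the other marks position, and position is
    shifted by \<open>s k\<close> at time \<open>k\<close>, so that no negative exponents occur. The sign of \<open>T\<^sub>k - s k\<close>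
    then becomes the side of the line \<open>j = s k\<close> on which a coefficient lies, and series living
    on one side are closed under multiplication (\<open>lindley_empty_recursion\<close>).

  \<^item> The value \<open>F \<beta>\<close> is the same series with \<open>P(T\<^sub>k > s k)\<close> replaced by the normal tail at
    \<open>\<beta> \<surd>k\<close>. By a Berry--Esseen bound (\<open>lattice_berry_esseen\<close>) the tail probability
    \<open>P(T\<^sub>k > s k)\<close> differs from the normal tail at \<open>b \<surd>k\<close>, with \<open>b = (s - n \<mu>) / \<surd>(n v)\<close>,
    by at most a constant over \<open>\<surd>(n k)\<close>. Dividing by \<open>k\<close> leaves a convergent series, so
    \<open>ln P(Q = 0)\<close> and \<open>- F b\<close> differ by \<open>O(n\<^sup>-\<^sup>1\<^sup>/\<^sup>2) = O(s\<^sup>-\<^sup>1\<^sup>/\<^sup>2)\<close> (\<open>empty_probability_gaussian\<close>). The Berry--Esseen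
    bound is obtained on the lattice directly: the law of \<open>T\<^sub>k\<close> is recovered from its
    characteristic function on \<open>[-\<pi>, \<pi>]\<close>, the normal law from Levy's inversion formula, and the
    dominance of the generating function on the unit circle keeps the characteristic function
    of \<open>X\<close> away from modulus one outside the origin.

  \<^item> Finally \<open>b = \<beta> / \<surd>\<rho>\<close> with \<open>\<rho> = n \<mu> / s\<close> and \<open>\<beta> = d(s) \<surd>2 = (1 - \<rho>) \<surd>(s \<mu> / v)\<close>, and passing from \<open>b\<close> to \<open>\<beta>\<close> costs
    \<open>(b - \<beta>) / \<beta>\<^sup>2 = O(s\<^sup>-\<^sup>1\<^sup>/\<^sup>2)\<close> in \<open>F\<close> (\<open>F_diff_le\<close>), since the factor \<open>1 - \<rho>\<close> cancels.

  Since \<open>\<beta>\<close> tends to \<open>0\<close>, \<open>F \<beta>\<close> stays above a positive constant, and \<open>s\<^sup>-\<^sup>1\<^sup>/\<^sup>2 \<le> s\<^bsup>\<alpha> - 1\<^esup>\<close> because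
  \<open>\<alpha> > 1/2\<close>; the absolute error \<open>O(s\<^sup>-\<^sup>1\<^sup>/\<^sup>2)\<close> is therefore a relative error \<open>O(s\<^bsup>\<alpha> - 1\<^esup>)\<close>.
\<close>

unbundle no vec_syntax and fps_syntax

section \<open>Sums of independent demands and the reflected walk\<close>

definition sum_pmf :: "nat pmf \<Rightarrow> nat pmf \<Rightarrow> nat pmf" where
  "sum_pmf p q = map_pmf (\<lambda>(x, y). x + y) (pair_pmf p q)"

primrec walk :: "nat pmf \<Rightarrow> nat \<Rightarrow> nat pmf" where
  "walk A 0 = return_pmf 0"
| "walk A (Suc k) = sum_pmf (walk A k) A"

text \<open>The law of the congestion process started from the empty system.\<close>

primrec lindley :: "nat \<Rightarrow> nat pmf \<Rightarrow> nat \<Rightarrow> nat pmf" where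
  "lindley s A 0 = return_pmf 0"
| "lindley s A (Suc k) = map_pmf (\<lambda>x. x - s) (sum_pmf (lindley s A k) A)"

definition pmf_fps :: "nat pmf \<Rightarrow> real fps" where
  "pmf_fps p = Abs_fps (pmf p)"

lemma pmf_fps_nth [simp]: "pmf_fps p $ j = pmf p j"
  by (simp add: pmf_fps_def)

lemma pmf_fps_return [simp]: "pmf_fps (return_pmf 0) = 1"
  by (rule fps_ext) (auto simp: indicator_def)

lemma pmf_fps_sum_pmf: "pmf_fps (sum_pmf p q) = pmf_fps p * pmf_fps q"
proof (rule fps_ext)
  fix m :: nat
  have eq: "(\<lambda>(x, y). x + y) -` {m} = (\<lambda>i. (i, m - i)) ` {0..m}"
    by (auto simp: image_iff)
  have "pmf (sum_pmf p q) m = measure (pair_pmf p q) ((\<lambda>i. (i, m - i)) ` {0..m})"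
    by (simp add: sum_pmf_def pmf_map eq)
  also have "\<dots> = (\<Sum>z\<in>(\<lambda>i. (i, m - i)) ` {0..m}. pmf (pair_pmf p q) z)"
    by (rule measure_measure_pmf_finite) simp
  also have "\<dots> = (\<Sum>i=0..m. pmf p i * pmf q (m - i))"
    by (subst sum.reindex) (auto simp: inj_on_def pmf_pair)
  finally show "pmf_fps (sum_pmf p q) $ m = (pmf_fps p * pmf_fps q) $ m"
    by (simp add: fps_mult_nth)
qed

lemma pmf_fps_walk: "pmf_fps (walk A k) = pmf_fps A ^ k"
  by (induction k) (simp_all add: pmf_fps_sum_pmf mult.commute)

lemma pmf_nat_sums: "pmf (p :: nat pmf) sums 1"
proof -
  have "(\<lambda>j. measure p {j}) sums measure p (\<Union>j. {j})"
    by (rule measure_pmf.finite_measure_UNION) (auto simp: disjoint_family_on_def)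
  moreover have "measure p (\<Union>j. {j}) = 1"
    using measure_pmf.prob_space[of p] by simp
  ultimately show ?thesis
    by (simp add: measure_pmf_single)
qed

section \<open>Wiener--Hopf factorisation in two formal variables\<close>

definition mass :: "real fps \<Rightarrow> real" where
  "mass f = (\<Sum>j. f $ j)"

lemma mass_pmf_fps [simp]: "mass (pmf_fps p) = 1"
  using pmf_nat_sums[of p] by (simp add: mass_def sums_iff)

text \<open>Total mass is multiplicative on absolutely summable series (Cauchy product). It plays the role
  of evaluation at \<open>z = 1\<close>, a point at which a formal power series has no value of its own.\<close>

lemma
  assumes "summable (\<lambda>j. norm (f $ j))" "summable (\<lambda>j. norm (g $ j))"
  shows summable_fps_mult: "summable (\<lambda>j. (f * g) $ j)"
    and mass_mult: "mass (f * g) = mass f * mass g"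
  using summable_Cauchy_product[OF assms] Cauchy_product[OF assms]
  by (simp_all add: mass_def fps_mult_nth atLeast0AtMost)

lemma mass_X_power_mult:
  assumes "summable (\<lambda>j. f $ j)"
  shows "summable (\<lambda>j. (fps_X ^ n * f) $ j)" "mass (fps_X ^ n * f) = mass f"
proof -
  have "(\<lambda>j. (fps_X ^ n * f) $ (j + n)) sums mass f"
    using assms by (simp add: mass_def fps_X_power_mult_nth summable_sums)
  then have "(\<lambda>j. (fps_X ^ n * f) $ j) sums mass f"
    using sums_zero_iff_shift[of n "\<lambda>j. (fps_X ^ n * f) $ j" "mass f"]
    by (simp only: fps_X_power_mult_nth) simp
  then show "summable (\<lambda>j. (fps_X ^ n * f) $ j)" "mass (fps_X ^ n * f) = mass f"
    by (auto simp: sums_iff mass_def)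
qed

text \<open>In a series \<open>f\<close> of series, \<open>f $ k $ j\<close> is the coefficient of \<open>t\<^sup>k z\<^sup>j\<close>. Because positions are
  shifted by \<open>s k\<close> at time \<open>k\<close>, the line \<open>j = s k\<close> is the origin of the walk; \<open>upper\<close> and \<open>lower\<close>
  are the series supported on its two closed sides.\<close>

definition upper :: "nat \<Rightarrow> real fps fps \<Rightarrow> bool" where
  "upper s f \<longleftrightarrow> (\<forall>k j. j < s * k \<longrightarrow> f $ k $ j = 0)"

definition lower :: "nat \<Rightarrow> real fps fps \<Rightarrow> bool" where
  "lower s f \<longleftrightarrow> (\<forall>k j. s * k < j \<longrightarrow> f $ k $ j = 0)"

lemma fps_fps_mult_nth:
  "(f * g) $ k $ j = (\<Sum>i=0..k. \<Sum>l=0..j. f $ i $ l * g $ (k - i) $ (j - l))"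
  for f g :: "real fps fps"
  by (simp add: fps_mult_nth fps_sum_nth)

text \<open>Both sides are convex cones, hence closed under addition of exponents.\<close>

lemma upper_mult: assumes "upper s f" "upper s g" shows "upper s (f * g)"
  unfolding upper_def
proof (intro allI impI)
  fix k j assume j: "j < s * k"
  have "f $ i $ l * g $ (k - i) $ (j - l) = 0" if "i \<le> k" "l \<le> j" for i l
  proof (cases "l < s * i")
    case False
    have "s * k = s * i + s * (k - i)" using that by (metis add_mult_distrib2 le_add_diff_inverse)
    then have "j - l < s * (k - i)" using j that False by linarith
    then show ?thesis using assms by (simp add: upper_def)
  qed (use assms in \<open>simp add: upper_def\<close>)
  then show "(f * g) $ k $ j = 0"
    unfolding fps_fps_mult_nth by (intro sum.neutral ballI) auto
qed

lemma lower_mult: assumes "lower s f" "lower s g" shows "lower s (f * g)"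
  unfolding lower_def
proof (intro allI impI)
  fix k j assume j: "s * k < j"
  have "f $ i $ l * g $ (k - i) $ (j - l) = 0" if "i \<le> k" "l \<le> j" for i l
  proof (cases "s * i < l")
    case False
    have "s * k = s * i + s * (k - i)" using that by (metis add_mult_distrib2 le_add_diff_inverse)
    then have "s * (k - i) < j - l" using j that False by linarith
    then show ?thesis using assms by (simp add: lower_def)
  qed (use assms in \<open>simp add: lower_def\<close>)
  then show "(f * g) $ k $ j = 0"
    unfolding fps_fps_mult_nth by (intro sum.neutral ballI) auto
qed

text \<open>The line bounding a cone is a face of it: a sum of exponents lies on the line only if both
  summands do. Reading off the coefficients on the line is thus multiplicative, and it is what
  extracts the probability of the empty system.\<close>

lemma upper_mult_diagonal:
  assumes "upper s f" "upper s g"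
  shows "(f * g) $ k $ (s * k) = (\<Sum>i=0..k. f $ i $ (s * i) * g $ (k - i) $ (s * (k - i)))"
  unfolding fps_fps_mult_nth
proof (rule sum.cong[OF refl])
  fix i assume "i \<in> {0..k}"
  then have sk: "s * k = s * i + s * (k - i)" by (metis add_mult_distrib2 le_add_diff_inverse atLeastAtMost_iff)
  have "(\<Sum>l=0..s * k. f $ i $ l * g $ (k - i) $ (s * k - l)) =
        (\<Sum>l\<in>{s * i}. f $ i $ l * g $ (k - i) $ (s * k - l))"
  proof (rule sum.mono_neutral_right)
    show "\<forall>l\<in>{0..s * k} - {s * i}. f $ i $ l * g $ (k - i) $ (s * k - l) = 0"
    proof
      fix l assume l: "l \<in> {0..s * k} - {s * i}"
      show "f $ i $ l * g $ (k - i) $ (s * k - l) = 0"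
      proof (cases "l < s * i")
        case False
        then have "s * k - l < s * (k - i)" using l sk by auto
        then show ?thesis using assms by (simp add: upper_def)
      qed (use assms in \<open>simp add: upper_def\<close>)
    qed
  qed (use sk in auto)
  then show "(\<Sum>l=0..s * k. f $ i $ l * g $ (k - i) $ (s * k - l)) =
      f $ i $ (s * i) * g $ (k - i) $ (s * (k - i))"
    using sk by simp
qed

lemma lower_summable:
  assumes "lower s f"
  shows "summable (\<lambda>j. norm (f $ k $ j))" "summable (\<lambda>j. f $ k $ j)"
proof -
  have zero: "f $ k $ j = 0" if "j \<notin> {..s * k}" for j
    using assms that by (simp add: lower_def)
  show "summable (\<lambda>j. norm (f $ k $ j))" "summable (\<lambda>j. f $ k $ j)"
    by (rule summable_finite[of "{..s * k}"], simp, simp add: zero)+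
qed

lemma lower_mass_mult:
  assumes "lower s f" "lower s g"
  shows "mass ((f * g) $ k) = (\<Sum>i=0..k. mass (f $ i) * mass (g $ (k - i)))"
proof -
  have "mass ((f * g) $ k) = (\<Sum>j. \<Sum>i=0..k. (f $ i * g $ (k - i)) $ j)"
    by (simp add: mass_def fps_mult_nth[of f] fps_sum_nth)
  also have "\<dots> = (\<Sum>i=0..k. mass (f $ i * g $ (k - i)))"
    unfolding mass_def
    by (intro suminf_sum summable_fps_mult lower_summable(1)[OF assms(1)] lower_summable(1)[OF assms(2)])
  also have "\<dots> = (\<Sum>i=0..k. mass (f $ i) * mass (g $ (k - i)))"
    by (intro sum.cong refl mass_mult lower_summable(1)[OF assms(1)] lower_summable(1)[OF assms(2)])
  finally show ?thesis .
qed

text \<open>This is Spitzer's identity in differentiated form. Let \<open>Q\<close> collect the laws of the reflected walk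
  and \<open>E = 1 - t A(z)\<close>. Reflection only moves mass from below the origin onto the origin, so
  \<open>D = Q E\<close> lives in the lower cone, and each of its coefficients beyond time \<open>0\<close> has mass zero.
  Taking the logarithmic derivative \<open>\<theta> = t d/dt\<close> of \<open>Q E = D\<close> gives \<open>\<theta>Q / Q - L = \<theta>D / D\<close> with
  \<open>L = \<Sum>\<^sub>k\<^sub>\<ge>\<^sub>1 (t A)\<^sup>k\<close>. Splitting \<open>L\<close> into an upper part \<open>Lp\<close> and a lower part \<open>Lm\<close> of mass zero separates
  the equation into \<open>\<theta>Q = Q Lp\<close> and \<open>\<theta>D = - D Lm\<close>, because upper series and mass-zero lower series
  only have \<open>0\<close> in common. The coefficients of \<open>\<theta>Q = Q Lp\<close> on the diagonal are the claim.\<close>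

theorem lindley_empty_recursion:
  fixes A :: "nat pmf" and s k :: nat
  defines "a \<equiv> (\<lambda>k. pmf (lindley s A k) 0)"
  shows "real k * a k = (\<Sum>i<k. a i * measure (walk A (k - i)) {..s * (k - i)})"
proof -
  define \<theta> :: "real fps fps \<Rightarrow> real fps fps" where "\<theta> = (\<lambda>f. fps_X * fps_deriv f)"
  have \<theta>_nth: "\<theta> f $ k $ j = real k * f $ k $ j" for f k j
    by (cases k) (simp_all add: \<theta>_def fps_of_nat[symmetric] del: of_nat_Suc)
  have \<theta>_mult: "\<theta> (f * g) = \<theta> f * g + f * \<theta> g" for f g
    by (simp add: \<theta>_def algebra_simps)
  define Q where "Q = Abs_fps (\<lambda>k. fps_X ^ (s * k) * pmf_fps (lindley s A k))"
  define E where "E = 1 - fps_X * fps_const (pmf_fps A)"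
  define D where "D = Q * E"
  define L where "L = Abs_fps (\<lambda>k. if k = 0 then 0 else pmf_fps A ^ k)"
  have L_nth: "L $ k $ j = (if k = 0 then 0 else pmf (walk A k) j)" for k j
    by (simp add: L_def pmf_fps_walk[symmetric])
  \<comment> \<open>The part of \<open>L\<close> strictly below the diagonal, corrected on the diagonal so that its mass is zero.\<close>
  define Lm where "Lm = Abs_fps (\<lambda>k. Abs_fps (\<lambda>j. if j < s * k then L $ k $ j
      else if j = s * k then - (\<Sum>j<s * k. L $ k $ j) else 0))"
  define Lp where "Lp = L - Lm"
  \<comment> \<open>The diagonal of \<open>Lp\<close> receives the mass removed from below it, so that it becomes \<open>P(T\<^sub>k \<le> s k)\<close>.\<close>
  have Lp_diag: "Lp $ k $ (s * k) = (if k = 0 then 0 else measure (walk A k) {..s * k})" for k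
  proof -
    have "Lp $ k $ (s * k) = (\<Sum>j<s * k. L $ k $ j) + L $ k $ (s * k)"
      by (simp add: Lp_def Lm_def)
    also have "\<dots> = (\<Sum>j\<le>s * k. L $ k $ j)"
      by (simp add: lessThan_Suc_atMost[symmetric])
    finally show ?thesis
      by (simp add: L_nth measure_measure_pmf_finite)
  qed
  have "upper s Lp" by (simp add: upper_def Lp_def Lm_def)
  have "lower s Lm" by (simp add: lower_def Lm_def)
  have Lm_mass: "mass (Lm $ k) = 0" for k
  proof -
    have "mass (Lm $ k) = (\<Sum>j\<in>{..s * k}. Lm $ k $ j)"
      unfolding mass_def by (rule suminf_finite) (auto simp: Lm_def)
    then show ?thesis
      by (simp add: Lm_def lessThan_Suc_atMost[symmetric])
  qed
  have "upper s Q" by (simp add: upper_def Q_def fps_X_power_mult_nth)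
  have Q_diag: "Q $ k $ (s * k) = a k" for k
    by (simp add: Q_def a_def fps_X_power_mult_nth)
  have "Q $ 0 = 1" by (simp add: Q_def)
  have "D $ 0 = 1" by (simp add: D_def E_def \<open>Q $ 0 = 1\<close> fps_mult_nth)
  have D_Suc: "D $ Suc k = Q $ Suc k - fps_X ^ (s * k) * pmf_fps (sum_pmf (lindley s A k) A)" for k
  proof -
    have "D = Q - fps_X * (Q * fps_const (pmf_fps A))" by (simp add: D_def E_def algebra_simps)
    then have "D $ Suc k = Q $ Suc k - Q $ k * pmf_fps A" by simp
    then show ?thesis by (simp add: Q_def pmf_fps_sum_pmf mult.assoc del: lindley.simps)
  qed
  have summable_pmf: "summable (\<lambda>j. pmf_fps p $ j)" for p
    using sums_summable[OF pmf_nat_sums[of p]] by simp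
  have D_mass: "mass (D $ Suc k) = 0" for k
  proof -
    have "mass (D $ Suc k) = mass (fps_X ^ (s * Suc k) * pmf_fps (lindley s A (Suc k)))
        - mass (fps_X ^ (s * k) * pmf_fps (sum_pmf (lindley s A k) A))"
      unfolding D_Suc mass_def Q_def fps_nth_Abs_fps fps_sub_nth
      by (intro suminf_diff[symmetric] mass_X_power_mult summable_pmf)
    then show ?thesis
      by (simp add: mass_X_power_mult[OF summable_pmf] del: lindley.simps)
  qed
  have "lower s D"
    unfolding lower_def
  proof (intro allI impI)
    fix k j assume "s * k < j"
    show "D $ k $ j = 0"
    proof (cases k)
      case 0
      then show ?thesis using \<open>D $ 0 = 1\<close> \<open>s * k < j\<close> by simp
    next
      case (Suc k')
      have j: "s + s * k' < j" using \<open>s * k < j\<close> Suc by simp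
      have "(\<lambda>x. x - s) -` {j - (s + s * k')} = {j - s * k'}"
        using j by auto
      then have "pmf (lindley s A (Suc k')) (j - (s + s * k')) =
          pmf (sum_pmf (lindley s A k') A) (j - s * k')"
        by (simp add: pmf_map measure_pmf_single)
      then show ?thesis using j
        by (simp add: Suc D_Suc Q_def fps_X_power_mult_nth del: lindley.simps)
    qed
  qed
  have LE: "L * E = fps_X * fps_const (pmf_fps A)"
  proof (rule fps_ext)
    fix k
    have "L * E = L - fps_X * (L * fps_const (pmf_fps A))" by (simp add: E_def algebra_simps)
    then show "(L * E) $ k = (fps_X * fps_const (pmf_fps A)) $ k"
      by (cases k) (auto simp: L_def)
  qed
  have \<theta>E: "\<theta> E = - (fps_X * fps_const (pmf_fps A))"
    by (simp add: \<theta>_def E_def)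
  \<comment> \<open>Both vanish; the identity \<open>D U = Q V\<close> ties them together without any division of series.\<close>
  define U where "U = \<theta> Q - Q * Lp"
  define V where "V = \<theta> D + D * Lm"
  have "D * U - Q * V = D * \<theta> Q - D * Q * L - Q * \<theta> D"
    by (simp add: U_def V_def Lp_def algebra_simps)
  also have "\<dots> = - Q * Q * (L * E + \<theta> E)"
    unfolding D_def \<theta>_mult by (simp add: algebra_simps)
  finally have DU: "D * U = Q * V" by (simp add: LE \<theta>E)
  have "upper s U"
    using upper_mult[OF \<open>upper s Q\<close> \<open>upper s Lp\<close>] \<open>upper s Q\<close>
    by (simp add: upper_def U_def \<theta>_nth)
  have "lower s V"
    using lower_mult[OF \<open>lower s D\<close> \<open>lower s Lm\<close>] \<open>lower s D\<close>
    by (simp add: lower_def V_def \<theta>_nth)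
  have V_mass: "mass (V $ k) = 0" for k
  proof -
    have "mass (V $ k) = (\<Sum>j. real k * D $ k $ j + (D * Lm) $ k $ j)"
      by (simp add: V_def mass_def \<theta>_nth)
    also have "\<dots> = real k * mass (D $ k) + mass ((D * Lm) $ k)"
      unfolding mass_def using lower_summable[OF \<open>lower s D\<close>]
        lower_summable[OF lower_mult[OF \<open>lower s D\<close> \<open>lower s Lm\<close>]]
      by (simp add: suminf_add[symmetric] suminf_mult summable_mult)
    also have "\<dots> = 0"
      using D_mass by (cases k)
        (simp_all add: lower_mass_mult[OF \<open>lower s D\<close> \<open>lower s Lm\<close>] Lm_mass \<open>D $ 0 = 1\<close>)
    finally show ?thesis .
  qed
  \<comment> \<open>The lowest non-zero coefficients of \<open>U\<close> and \<open>V\<close> would agree, hence sit on the diagonal with mass zero.\<close>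
  have "U $ k = 0 \<and> V $ k = 0" for k
  proof (induction k rule: less_induct)
    case (less k)
    have "(D * U) $ k = (\<Sum>i\<in>{0}. D $ i * U $ (k - i))"
      unfolding fps_mult_nth using less by (intro sum.mono_neutral_right) auto
    moreover have "(Q * V) $ k = (\<Sum>i\<in>{0}. Q $ i * V $ (k - i))"
      unfolding fps_mult_nth using less by (intro sum.mono_neutral_right) auto
    ultimately have UV: "U $ k = V $ k"
      using DU \<open>D $ 0 = 1\<close> \<open>Q $ 0 = 1\<close> by simp
    have off: "V $ k $ j = 0" if "j \<noteq> s * k" for j
      using that UV \<open>upper s U\<close> \<open>lower s V\<close> unfolding upper_def lower_def by (metis linorder_neqE_nat)
    have "mass (V $ k) = (\<Sum>j\<in>{s * k}. V $ k $ j)"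
      unfolding mass_def by (rule suminf_finite) (use off in auto)
    then have "V $ k $ (s * k) = 0" using V_mass by simp
    then have "V $ k = 0" using off by (intro fps_ext) (metis fps_zero_nth)
    then show ?case using UV by simp
  qed
  then have "0 = U $ k $ (s * k)" by simp
  also have "\<dots> = real k * a k - (\<Sum>i=0..k. a i * Lp $ (k - i) $ (s * (k - i)))"
    by (simp add: U_def \<theta>_nth Q_diag upper_mult_diagonal[OF \<open>upper s Q\<close> \<open>upper s Lp\<close>])
  also have "(\<Sum>i=0..k. a i * Lp $ (k - i) $ (s * (k - i))) =
      (\<Sum>i<k. a i * measure (walk A (k - i)) {..s * (k - i)})"
  proof -
    have "(\<Sum>i=0..k. a i * Lp $ (k - i) $ (s * (k - i))) = (\<Sum>i<k. a i * Lp $ (k - i) $ (s * (k - i)))"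
      using Lp_diag[of 0] by (simp add: atLeast0AtMost lessThan_Suc_atMost[symmetric])
    also have "\<dots> = (\<Sum>i<k. a i * measure (walk A (k - i)) {..s * (k - i)})"
      by (rule sum.cong) (auto simp: Lp_diag)
    finally show ?thesis .
  qed
  finally show ?thesis by simp
qed

section \<open>From finite time to the stationary law\<close>

definition pair_step :: "nat \<Rightarrow> nat pmf \<Rightarrow> nat \<times> nat \<Rightarrow> (nat \<times> nat) pmf" where
  "pair_step s A = (\<lambda>(x, t). map_pmf (\<lambda>a. (x + a - s, t + a)) A)"

text \<open>The reflected walk driven by the same demands as the unreflected total demand. Its marginals are
  \<open>lindley\<close> and \<open>walk\<close>, and it also determines the walk reflected from any other starting point.\<close>

primrec joint :: "nat \<Rightarrow> nat pmf \<Rightarrow> nat \<Rightarrow> (nat \<times> nat) pmf" where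
  "joint s A 0 = return_pmf (0, 0)"
| "joint s A (Suc k) = bind_pmf (joint s A k) (pair_step s A)"

lemma sum_pmf_bind: "sum_pmf p q = bind_pmf p (\<lambda>x. map_pmf (\<lambda>y. x + y) q)"
  by (simp add: sum_pmf_def pair_pmf_def map_bind_pmf map_pmf_def bind_assoc_pmf bind_return_pmf)

lemma map_fst_joint: "map_pmf fst (joint s A k) = lindley s A k"
proof (induction k)
  case (Suc k)
  have "map_pmf fst (joint s A (Suc k)) = bind_pmf (map_pmf fst (joint s A k)) (\<lambda>x. map_pmf (\<lambda>a. x + a - s) A)"
    by (simp add: map_bind_pmf bind_map_pmf)
       (rule bind_pmf_cong, auto simp: pair_step_def pmf.map_comp o_def)
  then show ?case by (simp add: Suc sum_pmf_bind map_bind_pmf pmf.map_comp o_def)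
qed simp

lemma map_snd_joint: "map_pmf snd (joint s A k) = walk A k"
proof (induction k)
  case (Suc k)
  have "map_pmf snd (joint s A (Suc k)) = bind_pmf (map_pmf snd (joint s A k)) (\<lambda>x. map_pmf (\<lambda>a. x + a) A)"
    by (simp add: map_bind_pmf bind_map_pmf)
       (rule bind_pmf_cong, auto simp: pair_step_def pmf.map_comp o_def)
  then show ?case by (simp add: Suc sum_pmf_bind)
qed simp

primrec iterate :: "('a \<Rightarrow> 'a pmf) \<Rightarrow> nat \<Rightarrow> 'a \<Rightarrow> 'a pmf" where
  "iterate K 0 x = return_pmf x"
| "iterate K (Suc k) x = bind_pmf (iterate K k x) K"

lemma bind_iterate_stationary:
  assumes "bind_pmf Q K = Q"
  shows "bind_pmf Q (iterate K k) = Q"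
proof (induction k)
  case 0
  show ?case by (simp add: bind_return_pmf' cong: bind_pmf_cong)
next
  case (Suc k)
  have "bind_pmf Q (iterate K (Suc k)) = bind_pmf (bind_pmf Q (iterate K k)) K"
    unfolding bind_assoc_pmf by (rule bind_pmf_cong) simp_all
  then show ?case by (simp only: Suc assms)
qed

text \<open>Pathwise, the queue started from \<open>q\<close> is the larger of the queue started from \<open>0\<close> and the
  unreflected walk \<open>q + T\<^sub>k - s k\<close>: the starting point is forgotten once that walk has gone below zero.
  Truncated subtraction is harmless because the other argument of the maximum is non-negative.\<close>

lemma iterate_eq_max:
  "iterate (\<lambda>q. map_pmf (\<lambda>a. q + a - s) A) k q =
    map_pmf (\<lambda>(x, t). max x (q + t - s * k)) (joint s A k)"
proof (induction k)
  case (Suc k)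
  have "max x (q + t - s * k) + a - s = max (x + a - s) (q + (t + a) - s * Suc k)" for x t a
    by (simp add: max_def) linarith
  then show ?case
    by (simp add: Suc bind_map_pmf map_bind_pmf)
       (rule bind_pmf_cong, auto simp: pair_step_def pmf.map_comp o_def split_beta)
qed simp

text \<open>Started from its stationary law, the queue is empty with the stationary probability at all times,
  whereas by \<open>iterate_eq_max\<close> it differs from the queue started at \<open>0\<close> only if \<open>q + T\<^sub>k > s k\<close>. Averaging
  that probability over the stationary law gives a vanishing bound by dominated convergence.\<close>

lemma stationary_empty_limit:
  assumes stat: "bind_pmf Q (\<lambda>q. map_pmf (\<lambda>a. q + a - s) A) = Q"
    and transient: "\<And>q. (\<lambda>k. measure (walk A k) {t. s * k < q + t}) \<longlonglongrightarrow> 0"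
  shows "(\<lambda>k. pmf (lindley s A k) 0) \<longlonglongrightarrow> pmf Q 0"
proof -
  let ?K = "\<lambda>q. map_pmf (\<lambda>a. q + a - s) A"
  let ?w = "\<lambda>k q. measure (walk A k) {t. s * k < q + t}"
  have diff: "\<bar>pmf (iterate ?K k q) 0 - pmf (lindley s A k) 0\<bar> \<le> ?w k q" for k q
  proof -
    let ?J = "measure_pmf (joint s A k)"
    have 1: "pmf (iterate ?K k q) 0 = measure ?J {z. fst z = 0 \<and> q + snd z \<le> s * k}"
      unfolding iterate_eq_max pmf_map
      by (intro arg_cong[where f="measure ?J"]) (auto simp: max_def split: if_splits)
    have 2: "pmf (lindley s A k) 0 = measure ?J {z. fst z = 0}"
      unfolding map_fst_joint[symmetric] pmf_map
      by (intro arg_cong[where f="measure ?J"]) auto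
    have 3: "?w k q = measure ?J {z. s * k < q + snd z}"
      unfolding map_snd_joint[symmetric, of A k s] measure_map_pmf
      by (intro arg_cong[where f="measure ?J"]) auto
    have "measure ?J {z. fst z = 0} = measure ?J ({z. fst z = 0 \<and> q + snd z \<le> s * k} \<union> {z. fst z = 0 \<and> s * k < q + snd z})"
      by (intro arg_cong[where f="measure ?J"]) auto
    also have "\<dots> = measure ?J {z. fst z = 0 \<and> q + snd z \<le> s * k} + measure ?J {z. fst z = 0 \<and> s * k < q + snd z}"
      by (intro measure_pmf.finite_measure_Union) auto
    finally have 4: "measure ?J {z. fst z = 0} = measure ?J {z. fst z = 0 \<and> q + snd z \<le> s * k} + measure ?J {z. fst z = 0 \<and> s * k < q + snd z}" .
    have 5: "measure ?J {z. fst z = 0 \<and> s * k < q + snd z} \<le> measure ?J {z. s * k < q + snd z}"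
      by (intro measure_pmf.finite_measure_mono) auto
    show ?thesis using 4 5 unfolding 1 2 3 by simp
  qed
  have int: "integrable (measure_pmf Q) f" if "\<And>q. \<bar>f q\<bar> \<le> (1 :: real)" for f
    using that by (intro measure_pmf.integrable_const_bound[where B = 1]) auto
  have bound: "\<bar>pmf Q 0 - pmf (lindley s A k) 0\<bar> \<le> measure_pmf.expectation Q (?w k)" for k
  proof -
    have "pmf Q 0 = measure_pmf.expectation Q (\<lambda>q. pmf (iterate ?K k q) 0)"
      using bind_iterate_stationary[OF stat, of k] by (metis pmf_bind)
    then have "pmf Q 0 - pmf (lindley s A k) 0 =
        measure_pmf.expectation Q (\<lambda>q. pmf (iterate ?K k q) 0 - pmf (lindley s A k) 0)"
      by (subst Bochner_Integration.integral_diff) (auto intro!: int simp: pmf_le_1)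
    also have "\<bar>\<dots>\<bar> \<le> measure_pmf.expectation Q (\<lambda>q. \<bar>pmf (iterate ?K k q) 0 - pmf (lindley s A k) 0\<bar>)"
      by (rule integral_abs_bound)
    also have "\<dots> \<le> measure_pmf.expectation Q (?w k)"
      using diff by (intro integral_mono int) (auto intro: order_trans[OF diff measure_pmf.prob_le_1])
    finally show ?thesis .
  qed
  have "(\<lambda>k. measure_pmf.expectation Q (?w k)) \<longlonglongrightarrow> measure_pmf.expectation Q (\<lambda>q. 0)"
    by (rule integral_dominated_convergence[where w="\<lambda>_. 1"]) (use transient in auto)
  then have "(\<lambda>k. measure_pmf.expectation Q (?w k)) \<longlonglongrightarrow> 0" by simp
  then have "(\<lambda>k. pmf Q 0 - pmf (lindley s A k) 0) \<longlonglongrightarrow> 0"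
    by (rule Lim_null_comparison[rotated]) (use bound in auto)
  then show ?thesis
    using tendsto_diff[OF tendsto_const[of "pmf Q 0"]] by force
qed

lemma fps_conv_radius_bounded:
  fixes f :: "real fps"
  assumes "\<And>k. \<bar>f $ k\<bar> \<le> 1"
  shows "fps_conv_radius f \<ge> 1"
  unfolding fps_conv_radius_def
proof (rule conv_radius_geI_ex)
  fix r :: real assume r: "0 < r" "ereal r < 1"
  have "summable (\<lambda>n. f $ n * r ^ n)"
  proof (rule summable_comparison_test'[where N = 0])
    show "summable (\<lambda>n. r ^ n)" using r by (intro summable_geometric) simp
    show "norm (f $ n * r ^ n) \<le> r ^ n" for n
      using r assms[of n] by (simp add: abs_mult mult_left_le_one_le)
  qed
  then show "\<exists>z. norm z = r \<and> summable (\<lambda>n. f $ n * z ^ n)"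
    using r by (intro exI[of _ r]) simp
qed

text \<open>Abel's theorem in the form for limits of sequences: \<open>(1 - t) \<Sum>\<^sub>k a\<^sub>k t\<^sup>k\<close> averages the sequence with
  weights that move off to infinity as \<open>t\<close> tends to \<open>1\<close>.\<close>

lemma abelian_limit:
  fixes a :: "nat \<Rightarrow> real"
  assumes lim: "a \<longlonglongrightarrow> l"
  shows "((\<lambda>t. (1 - t) * (\<Sum>k. a k * t ^ k)) \<longlongrightarrow> l) (at_left 1)"
proof (rule tendstoI)
  fix \<epsilon> :: real assume "\<epsilon> > 0"
  obtain K where K: "\<And>k. k \<ge> K \<Longrightarrow> \<bar>a k - l\<bar> < \<epsilon> / 2"
    using lim \<open>\<epsilon> > 0\<close> by (metis LIMSEQ_iff half_gt_zero real_norm_def)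
  obtain B where B: "\<And>k. \<bar>a k\<bar> \<le> B"
    using convergent_imp_Bseq[OF convergentI[OF lim]] by (auto simp: Bseq_def)
  \<comment> \<open>The terms before \<open>K\<close> contribute at most \<open>(1 - t) M\<close>, all later ones at most \<open>\<epsilon> / 2\<close>.\<close>
  define M where "M = (\<Sum>k<K. \<bar>a k - l\<bar>)"
  have "((\<lambda>t. (1 - t) * M) \<longlongrightarrow> (1 - 1) * M) (at_left 1)"
    by (intro tendsto_intros)
  then have "((\<lambda>t. (1 - t) * M) \<longlongrightarrow> 0) (at_left 1)" by simp
  then have "eventually (\<lambda>t. (1 - t) * M < \<epsilon> / 2) (at_left 1)"
    by (rule order_tendstoD) (use \<open>\<epsilon> > 0\<close> in simp)
  moreover have "eventually (\<lambda>t :: real. t \<in> {0<..<1}) (at_left 1)"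
    by (rule eventually_at_left_real) simp
  ultimately show "eventually (\<lambda>t. dist ((1 - t) * (\<Sum>k. a k * t ^ k)) l < \<epsilon>) (at_left 1)"
  proof eventually_elim
    case (elim t)
    then have t: "0 < t" "t < 1" by auto
    have sg: "summable (\<lambda>k. t ^ k)" and geo: "(\<Sum>k. t ^ k) = 1 / (1 - t)"
      using t by (auto intro: summable_geometric suminf_geometric)
    have sa: "summable (\<lambda>k. a k * t ^ k)"
      using sg B t by (intro summable_comparison_test'[OF summable_mult[OF sg, of B], of 0])
        (auto simp: abs_mult intro!: mult_right_mono)
    have sh: "summable (\<lambda>k. if k \<in> {..<K} then \<bar>a k - l\<bar> else 0)"
      by (rule summable_If_finite_set) simp
    have bd: "\<bar>(a k - l) * t ^ k\<bar> \<le> (if k \<in> {..<K} then \<bar>a k - l\<bar> else 0) + \<epsilon> / 2 * t ^ k" for k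
    proof (cases "k < K")
      case True
      have "\<bar>a k - l\<bar> * t ^ k \<le> \<bar>a k - l\<bar> * 1" using t by (intro mult_left_mono power_le_one) auto
      moreover have "0 \<le> \<epsilon> / 2 * t ^ k" using t \<open>\<epsilon> > 0\<close> by simp
      ultimately show ?thesis using True t by (simp add: abs_mult)
    next
      case False
      then have "\<bar>a k - l\<bar> * t ^ k \<le> \<epsilon> / 2 * t ^ k" using K[of k] t by (intro mult_right_mono) auto
      then show ?thesis using False t by (simp add: abs_mult)
    qed
    have se: "summable (\<lambda>k. (if k \<in> {..<K} then \<bar>a k - l\<bar> else 0) + \<epsilon> / 2 * t ^ k)"
      by (intro summable_add sh summable_mult sg)
    have sd: "summable (\<lambda>k. \<bar>(a k - l) * t ^ k\<bar>)"
      by (rule summable_comparison_test'[OF se, of 0]) (use bd in auto)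
    have "(\<Sum>k. (a k - l) * t ^ k) = (\<Sum>k. a k * t ^ k) - l / (1 - t)"
      using suminf_diff[OF sa summable_mult[OF sg, of l]] suminf_mult[OF sg, of l] geo
      by (simp add: algebra_simps)
    then have "(1 - t) * (\<Sum>k. a k * t ^ k) - l = (1 - t) * (\<Sum>k. (a k - l) * t ^ k)"
      using t by (simp add: field_simps)
    also have "\<bar>\<dots>\<bar> = (1 - t) * \<bar>\<Sum>k. (a k - l) * t ^ k\<bar>"
      using t by (simp add: abs_mult)
    also have "\<dots> \<le> (1 - t) * (\<Sum>k. \<bar>(a k - l) * t ^ k\<bar>)"
      using t sd by (intro mult_left_mono summable_rabs) auto
    also have "\<dots> \<le> (1 - t) * (\<Sum>k. (if k \<in> {..<K} then \<bar>a k - l\<bar> else 0) + \<epsilon> / 2 * t ^ k)"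
      using t by (intro mult_left_mono suminf_le bd sd se) auto
    also have "(\<Sum>k. (if k \<in> {..<K} then \<bar>a k - l\<bar> else 0) + \<epsilon> / 2 * t ^ k) = M + \<epsilon> / 2 * (1 / (1 - t))"
      by (subst suminf_add[symmetric, OF sh summable_mult[OF sg]], subst suminf_mult[OF sg], subst geo,
          subst suminf_finite[of "{..<K}"]) (auto simp: M_def)
    also have "(1 - t) * \<dots> = (1 - t) * M + \<epsilon> / 2"
      using t by (simp add: field_simps)
    finally show ?case using elim by (simp add: dist_real_def)
  qed
qed

text \<open>With \<open>P = \<Sum>\<^sub>k a\<^sub>k t\<^sup>k\<close> and \<open>G = \<Sum>\<^sub>k\<^sub>\<ge>\<^sub>1 e\<^sub>k t\<^sup>k / k\<close>, the recursion says that \<open>R = (1 - t) P\<close> satisfies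
  \<open>R' = - R G'\<close>. Hence \<open>R = exp (- G)\<close> on \<open>[0, 1)\<close>, and the claim is the limit of this identity as
  \<open>t\<close> tends to \<open>1\<close>.\<close>

lemma exponential_recursion_limit:
  fixes a e :: "nat \<Rightarrow> real"
  assumes rec: "\<And>k. real k * a k = (\<Sum>i<k. a i * (1 - e (k - i)))"
    and a0: "a 0 = 1" and a_le: "\<And>k. \<bar>a k\<bar> \<le> 1"
    and e_bounds: "\<And>k. 0 \<le> e k" "\<And>k. e k \<le> 1"
    and e_summable: "summable (\<lambda>k. e (Suc k) / real (Suc k))"
    and lim: "a \<longlonglongrightarrow> l"
  shows "l = exp (- (\<Sum>k. e (Suc k) / real (Suc k)))"
proof -
  define P where "P = Abs_fps a"
  define g where "g k = e k / real k" for k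
  define G where "G = Abs_fps g"
  define H where "H = Abs_fps (\<lambda>k::nat. if k = 0 then 0 else 1 :: real)"
  define R where "R = (1 - fps_X) * P"
  have g0: "g 0 = 0" by (simp add: g_def)
  have B: "H - fps_X * fps_deriv G = Abs_fps (\<lambda>k. if k = 0 then 0 else 1 - e k)"
  proof (rule fps_ext)
    fix k show "(H - fps_X * fps_deriv G) $ k = Abs_fps (\<lambda>k. if k = 0 then 0 else 1 - e k) $ k"
      by (cases k) (simp_all add: H_def G_def g_def del: of_nat_Suc)
  qed
  have "fps_X * fps_deriv P = P * (H - fps_X * fps_deriv G)"
  proof (rule fps_ext)
    fix k
    have "(P * (H - fps_X * fps_deriv G)) $ k = (\<Sum>i=0..k. a i * (if k - i = 0 then 0 else 1 - e (k - i)))"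
      by (simp add: B fps_mult_nth P_def)
    also have "\<dots> = (\<Sum>i<k. a i * (1 - e (k - i)))"
      by (simp add: atLeast0AtMost lessThan_Suc_atMost[symmetric])
    also have "\<dots> = real k * a k" by (rule rec[symmetric])
    also have "\<dots> = (fps_X * fps_deriv P) $ k"
      by (cases k) (simp_all add: P_def)
    finally show "(fps_X * fps_deriv P) $ k = (P * (H - fps_X * fps_deriv G)) $ k" by simp
  qed
  then have PX: "fps_X * fps_deriv P = P * H - P * fps_X * fps_deriv G" by (simp only: algebra_simps)
  have HX: "(1 - fps_X) * H = fps_X"
  proof (rule fps_ext)
    fix k have "(1 - fps_X) * H = H - fps_X * H" by (simp add: algebra_simps)
    then show "((1 - fps_X) * H) $ k = fps_X $ k" by (cases k) (auto simp: H_def)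
  qed
  have "fps_X * fps_deriv R = (1 - fps_X) * (fps_X * fps_deriv P) - fps_X * P"
    by (simp add: R_def algebra_simps)
  also have "\<dots> = P * ((1 - fps_X) * H) - R * fps_X * fps_deriv G - fps_X * P"
    unfolding PX R_def by (simp only: algebra_simps)
  also have "\<dots> = fps_X * (- R * fps_deriv G)"
    unfolding HX by (simp add: algebra_simps)
  finally have "fps_X * fps_deriv R = fps_X * (- R * fps_deriv G)" .
  then have dR: "fps_deriv R = - R * fps_deriv G"
    by (simp only: mult_cancel_left fps_X_neq_zero simp_thms)
  have radP: "fps_conv_radius P \<ge> 1"
    by (rule fps_conv_radius_bounded) (simp add: P_def a_le)
  have g_le: "\<bar>g k\<bar> \<le> 1" for k
    using e_bounds[of k] by (cases k) (auto simp: g_def divide_simps)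
  have radG: "fps_conv_radius G \<ge> 1"
    by (rule fps_conv_radius_bounded) (simp add: G_def g_le)
  have radR: "fps_conv_radius R \<ge> 1"
  proof -
    have "fps_conv_radius (1 - fps_X :: real fps) = \<infinity>"
      using fps_conv_radius_diff[of 1 "fps_X :: real fps"] by simp
    then have "fps_conv_radius P \<le> fps_conv_radius R"
      unfolding R_def using fps_conv_radius_mult[of "1 - fps_X" P] by simp
    with radP show ?thesis by (rule order_trans)
  qed
  have ident: "(1 - t) * (\<Sum>k. a k * t ^ k) = exp (- (\<Sum>k. g k * t ^ k))" if t: "0 < t" "t < 1" for t
  proof -
    have small: "ereal (norm x) < fps_conv_radius f" if "x \<in> {0..t}" "fps_conv_radius f \<ge> 1" for x and f :: "real fps"
      using that t by (intro less_le_trans[OF _ that(2)]) simp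
    let ?h = "\<lambda>x. eval_fps R x * exp (eval_fps G x)"
    \<comment> \<open>By \<open>dR\<close> the derivative of \<open>R exp G\<close> vanishes on \<open>[0, t]\<close>.\<close>
    have "?h t = ?h 0"
    proof (rule DERIV_isconst_end[OF t(1)])
      have d: "(?h has_real_derivative 0) (at x)" if "x \<in> {0..t}" for x
      proof -
        have "eval_fps (fps_deriv R) x = - eval_fps R x * eval_fps (fps_deriv G) x"
          unfolding dR using small[OF that radR] small[OF that order_trans[OF radG fps_conv_radius_deriv]]
          by (subst eval_fps_mult) (auto simp: eval_fps_minus)
        moreover have "(?h has_real_derivative (eval_fps (fps_deriv R) x * exp (eval_fps G x)
              + exp (eval_fps G x) * eval_fps (fps_deriv G) x * eval_fps R x)) (at x)"
          by (intro DERIV_mult DERIV_fun_exp has_field_derivative_eval_fps small[OF that] radR radG)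
        ultimately show ?thesis by (simp add: algebra_simps)
      qed
      then show "continuous_on {0..t} ?h"
        by (meson DERIV_isCont continuous_at_imp_continuous_on)
      show "DERIV ?h x :> 0" if "0 < x" "x < t" for x using d that by simp
    qed
    also have "?h 0 = 1" by (simp add: eval_fps_at_0 R_def P_def G_def g0 a0)
    finally have "eval_fps R t = exp (- eval_fps G t)"
      by (simp add: exp_minus field_simps)
    moreover have "eval_fps R t = (1 - t) * eval_fps P t"
      unfolding R_def using small[OF _ radP, of t] t
      by (subst eval_fps_mult) (auto simp: eval_fps_diff intro: less_le_trans[OF _ fps_conv_radius_diff])
    ultimately show ?thesis by (simp add: eval_fps_def P_def G_def)
  qed
  have in01: "eventually (\<lambda>t :: real. t \<in> {0<..<1}) (at_left 1)"
    by (rule eventually_at_left_real) simp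
  have g_summable: "summable g"
    using e_summable by (subst summable_Suc_iff[symmetric]) (simp add: g_def)
  have "((\<lambda>t. \<Sum>k. g k * t ^ k) \<longlongrightarrow> (\<Sum>k. g k * 1 ^ k)) (at_left 1)"
  proof (rule conjunct2[OF conjunct2[OF tannerys_theorem[where M = g]]])
    show "((\<lambda>t. g k * t ^ k) \<longlongrightarrow> g k * 1 ^ k) (at_left 1)" for k
      by (intro tendsto_intros)
    have "eventually (\<lambda>(k, t). t \<in> {0<..<1 :: real}) ((at_top :: nat filter) \<times>\<^sub>F at_left 1)"
      using eventually_prod2[of "at_top :: nat filter" "\<lambda>t. t \<in> {0<..<1 :: real}" "at_left 1"] in01 by simp
    then show "eventually (\<lambda>(k, t). norm (g k * t ^ k) \<le> g k) (at_top \<times>\<^sub>F at_left 1)"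
    proof eventually_elim
      case (elim z)
      then show ?case using e_bounds
        by (auto simp: abs_mult g_def intro!: divide_right_mono mult_left_le power_le_one)
    qed
  qed (use g_summable in auto)
  then have "((\<lambda>t. exp (- (\<Sum>k. g k * t ^ k))) \<longlongrightarrow> exp (- (\<Sum>k. g k * 1 ^ k))) (at_left 1)"
    by (intro tendsto_intros)
  moreover have "((\<lambda>t. exp (- (\<Sum>k. g k * t ^ k))) \<longlongrightarrow> l) (at_left 1)"
    using abelian_limit[OF lim]
    by (rule Lim_transform_eventually) (use in01 ident in \<open>auto elim!: eventually_mono\<close>)
  ultimately have "l = exp (- (\<Sum>k. g k))"
    using tendsto_unique[OF trivial_limit_at_left_real] by auto
  also have "(\<Sum>k. g k) = (\<Sum>k. g (Suc k))"
    using suminf_split_head[OF g_summable] by (simp add: g0)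
  finally show ?thesis by (simp add: g_def)
qed

text \<open>Spitzer's formula. Transience of the walk removes the influence of the stationary starting point, and
  summability lets the limit \<open>t \<rightarrow> 1\<close> be taken inside the exponential.\<close>

theorem stationary_empty_formula:
  assumes stat: "bind_pmf Q (\<lambda>q. map_pmf (\<lambda>a. q + a - s) A) = Q"
    and transient: "\<And>q. (\<lambda>k. measure (walk A k) {t. s * k < q + t}) \<longlonglongrightarrow> 0"
    and summable: "summable (\<lambda>m. measure (walk A (Suc m)) {s * Suc m<..} / real (Suc m))"
  shows "pmf Q 0 = exp (- (\<Sum>m. measure (walk A (Suc m)) {s * Suc m<..} / real (Suc m)))"
proof (rule exponential_recursion_limit[where a = "\<lambda>k. pmf (lindley s A k) 0" and e = "\<lambda>k. measure (walk A k) {s * k<..}"])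
  fix k
  have "measure (walk A m) {..s * m} = 1 - measure (walk A m) {s * m<..}" for m
  proof -
    have "measure (walk A m) (UNIV - {s * m<..}) = 1 - measure (walk A m) {s * m<..}"
      using measure_pmf.prob_compl[of "{s * m<..}" "walk A m"] by simp
    moreover have "UNIV - {s * m<..} = {..s * m}" by auto
    ultimately show ?thesis by simp
  qed
  then show "real k * pmf (lindley s A k) 0 = (\<Sum>i<k. pmf (lindley s A i) 0 * (1 - measure (walk A (k - i)) {s * (k - i)<..}))"
    using lindley_empty_recursion[of k s A] by simp
next
  show "(\<lambda>k. pmf (lindley s A k) 0) \<longlonglongrightarrow> pmf Q 0"
    by (rule stationary_empty_limit[OF stat transient])
  show "summable (\<lambda>m. measure (walk A (Suc m)) {s * Suc m<..} / real (Suc m))"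
    by (rule summable)
qed (simp_all add: pmf_le_1)

section \<open>Characteristic functions of lattice laws\<close>

lemma pmf_sum_pmf: "pmf (sum_pmf p q) m = (\<Sum>i\<le>m. pmf p i * pmf q (m - i))"
  using pmf_fps_sum_pmf[of p q, THEN arg_cong, of "\<lambda>f. fps_nth f m"]
  by (simp add: fps_mult_nth atLeast0AtMost)

lemma expectation_nat_sums:
  fixes f :: "nat \<Rightarrow> 'b :: {banach, second_countable_topology}"
  assumes "integrable (measure_pmf p) f"
  shows "(\<lambda>j. pmf p j *\<^sub>R f j) sums measure_pmf.expectation p f"
proof -
  have "integrable (count_space UNIV) (\<lambda>j. pmf p j *\<^sub>R f j)"
    using assms by (simp add: measure_pmf_eq_density integrable_density)
  moreover have "measure_pmf.expectation p f = (LINT j|count_space UNIV. pmf p j *\<^sub>R f j)"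
    by (simp add: measure_pmf_eq_density integral_density)
  ultimately show ?thesis using sums_integral_count_space_nat by metis
qed

text \<open>The characteristic function of a law on the natural numbers; it has period \<open>2\<pi>\<close>.\<close>

definition cf :: "nat pmf \<Rightarrow> real \<Rightarrow> complex" where
  "cf p t = measure_pmf.expectation p (\<lambda>k. iexp (t * real k))"

lemma integrable_iexp_pmf: "integrable (measure_pmf p) (\<lambda>k. iexp (t * real k))"
  by (intro measure_pmf.integrable_const_bound[where B = 1]) auto

lemma cf_sums: "(\<lambda>j. of_real (pmf p j) * iexp (t * real j)) sums cf p t"
  using expectation_nat_sums[OF integrable_iexp_pmf[of p t]]
  by (simp add: cf_def scaleR_conv_of_real)

lemma cf_return: "cf (return_pmf 0) t = 1"
  by (simp add: cf_def)

lemma cf_sum_pmf: "cf (sum_pmf p q) t = cf p t * cf q t"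
proof -
  let ?f = "\<lambda>p j. complex_of_real (pmf p j) * iexp (t * real j)"
  have s: "summable (\<lambda>j. norm (?f p j))" for p
    using sums_summable[OF pmf_nat_sums[of p]] by (simp add: norm_mult)
  have "(\<Sum>i\<le>m. ?f p i * ?f q (m - i)) = ?f (sum_pmf p q) m" for m
  proof -
    have "?f p i * ?f q (m - i) = of_real (pmf p i * pmf q (m - i)) * iexp (t * real m)" if "i \<le> m" for i
      using that by (simp add: exp_add[symmetric] of_nat_diff algebra_simps)
    then have "(\<Sum>i\<le>m. ?f p i * ?f q (m - i)) =
        (\<Sum>i\<le>m. of_real (pmf p i * pmf q (m - i)) * iexp (t * real m))"
      by (intro sum.cong) auto
    then show ?thesis by (simp add: pmf_sum_pmf sum_distrib_right)
  qed
  then have "(\<lambda>m. ?f (sum_pmf p q) m) sums (cf p t * cf q t)"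
    using Cauchy_product_sums[OF s[of p] s[of q]] cf_sums[of p t] cf_sums[of q t] by (simp add: sums_iff)
  then show ?thesis using cf_sums sums_unique2 by blast
qed

lemma cf_walk: "cf (walk A k) t = cf A t ^ k"
  by (induction k) (simp_all add: cf_return cf_sum_pmf mult.commute)

lemma demand_Suc: "demand (Suc n) X = sum_pmf X (demand n X)"
  by (simp add: demand_def sum_pmf_def pair_pmf_def map_pmf_def bind_assoc_pmf bind_return_pmf)

lemma cf_demand: "cf (demand n X) t = cf X t ^ n"
proof (induction n)
  case 0
  then show ?case by (simp add: demand_def cf_return)
qed (simp add: demand_Suc cf_sum_pmf)

lemma integral_iexp_period:
  fixes m :: int
  shows "(LBINT t:{-pi..pi}. iexp (t * real_of_int m)) = (if m = 0 then 2 * pi else 0)"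
proof (cases "m = 0")
  case True
  then show ?thesis by (simp add: set_lebesgue_integral_def scaleR_conv_of_real)
next
  case False
  have "(LBINT t:{-pi..pi}. iexp (t * real_of_int m)) = (LBINT t=-pi..pi. iexp (t * real_of_int m))"
    by (simp add: interval_integral_Icc)
  also have "\<dots> = iexp (pi * real_of_int m) / (\<i> * m) - iexp (- pi * real_of_int m) / (\<i> * m)"
  proof (rule interval_integral_FTC_finite)
    show "continuous_on {min (- pi) pi..max (- pi) pi} (\<lambda>t. iexp (t * real_of_int m))"
      by (intro continuous_intros)
    fix x :: real
    have "((\<lambda>z. exp (\<i> * (z * of_int m)) / (\<i> * of_int m)) has_field_derivative exp (\<i> * (of_real x * of_int m))) (at (of_real x))"
      using False by (auto intro!: derivative_eq_intros simp: mult.commute[of "exp _" \<i>])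
    then have "((\<lambda>x. exp (\<i> * (of_real x * of_int m)) / (\<i> * of_int m)) has_vector_derivative exp (\<i> * (of_real x * of_int m))) (at x within {min (- pi) pi..max (- pi) pi})"
      by (rule has_vector_derivative_real_field)
    then show "((\<lambda>t. iexp (t * real_of_int m) / (\<i> * m)) has_vector_derivative iexp (x * real_of_int m)) (at x within {min (- pi) pi..max (- pi) pi})"
      by simp
  qed
  also have "iexp (- pi * real_of_int m) = iexp (pi * real_of_int m)"
    by (simp add: exp_eq mult_ac) (rule exI[of _ "-m"], simp)
  finally show ?thesis using False by simp
qed

text \<open>Fourier coefficients of \<open>cf W\<close>: integrate the series defining \<open>cf W\<close> term by term over one period.\<close>

lemma pmf_inversion:
  "complex_of_real (pmf W j) = (LBINT t:{-pi..pi}. cf W t * iexp (- (t * real j))) / (2 * pi)"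
proof -
  define f where "f k t = indicator {-pi..pi} t *\<^sub>R (of_real (pmf W k) * iexp (t * real k) * iexp (- (t * real j)))" for k t
  have cont: "set_integrable lborel {-pi..pi} (\<lambda>t. of_real (pmf W k) * iexp (t * real k) * iexp (- (t * real j)))" for k
    by (intro borel_integrable_atLeastAtMost' continuous_intros)
  have norm_f: "norm (f k t) = pmf W k * indicator {-pi..pi} t" for k t
    by (auto simp: f_def norm_mult split: split_indicator)
  have int_f: "integral\<^sup>L lborel (f k) = (if k = j then 2 * pi * pmf W j else 0)" for k
  proof -
    have "integral\<^sup>L lborel (f k) = (LBINT t:{-pi..pi}. of_real (pmf W k) * iexp (t * real_of_int (int k - int j)))"
      unfolding set_lebesgue_integral_def f_def
      by (intro Bochner_Integration.integral_cong refl arg_cong2[where f=scaleR])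
         (simp add: exp_add[symmetric] algebra_simps)
    also have "\<dots> = of_real (pmf W k) * (LBINT t:{-pi..pi}. iexp (t * real_of_int (int k - int j)))"
      by simp
    finally show ?thesis unfolding integral_iexp_period by simp
  qed
  have "(\<lambda>k. integral\<^sup>L lborel (f k)) sums (LINT t|lborel. (\<Sum>k. f k t))"
  proof (rule sums_integral)
    show "integrable lborel (f k)" for k
      using cont[of k] by (simp add: f_def[abs_def] set_integrable_def)
    show "AE t in lborel. summable (\<lambda>k. norm (f k t))"
      unfolding norm_f by (intro AE_I2 summable_mult2 sums_summable[OF pmf_nat_sums])
    show "summable (\<lambda>k. LINT t|lborel. norm (f k t))"
      unfolding norm_f by (simp add: summable_mult2 sums_summable[OF pmf_nat_sums])
  qed
  moreover have "(\<lambda>k. integral\<^sup>L lborel (f k)) sums (2 * pi * pmf W j)"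
    unfolding int_f using sums_single[of j "\<lambda>j. complex_of_real (2 * pi * pmf W j)"] by (simp add: if_distrib cong: if_cong)
  moreover have "(\<Sum>k. f k t) = indicator {-pi..pi} t *\<^sub>R (cf W t * iexp (- (t * real j)))" for t
    unfolding f_def using sums_scaleR_right[OF sums_mult2[OF cf_sums[of W t], of "iexp (- (t * real j))"], of "indicator {-pi..pi} t"]
    by (simp add: sums_iff)
  ultimately have "(LBINT t:{-pi..pi}. cf W t * iexp (- (t * real j))) = 2 * pi * pmf W j"
    unfolding set_lebesgue_integral_def using sums_unique2 by force
  then show ?thesis by simp
qed

text \<open>Link to characteristic functions of real distributions, through which continuity and the moment
  expansion are inherited.\<close>

lemma char_shifted_pmf:
  "char (distr (measure_pmf p) borel (\<lambda>k. real k - c)) t = iexp (- (t * c)) * cf p t"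
proof -
  have "char (distr (measure_pmf p) borel (\<lambda>k. real k - c)) t =
      measure_pmf.expectation p (\<lambda>k. iexp (- (t * c)) * iexp (t * real k))"
    unfolding char_def by (subst integral_distr) (auto simp: exp_add[symmetric] algebra_simps)
  then show ?thesis by (simp add: cf_def)
qed

lemma real_distribution_shifted_pmf:
  "real_distribution (distr (measure_pmf p) borel (\<lambda>k. real k - c))"
  by (intro prob_space.real_distribution_distr prob_space_measure_pmf) simp

lemma continuous_on_cf: "continuous_on S (cf p)"
proof -
  interpret real_distribution "distr (measure_pmf p) borel (\<lambda>k. real k - 0)"
    by (rule real_distribution_shifted_pmf)
  have "char (distr (measure_pmf p) borel (\<lambda>k. real k - 0)) = cf p"
    by (rule ext) (use char_shifted_pmf[of p 0] in simp)
  then have "isCont (cf p) t" for t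
    using isCont_char[of t] by simp
  then show ?thesis by (simp add: continuous_at_imp_continuous_on)
qed

lemma prob_interval_inversion:
  fixes W :: "nat pmf"
  shows "complex_of_real (measure W {a<..b}) =
    (LBINT t:{-pi..pi}. cf W t * (\<Sum>j\<in>{a<..b}. iexp (- (t * real j)))) / (2 * pi)"
proof -
  have int: "set_integrable lborel {-pi..pi} (\<lambda>t. cf W t * iexp (- (t * real j)))" for j
    by (intro borel_integrable_atLeastAtMost' continuous_intros continuous_on_cf)
  have "complex_of_real (measure W {a<..b}) = (\<Sum>j\<in>{a<..b}. of_real (pmf W j))"
    by (simp add: measure_measure_pmf_finite)
  also have "\<dots> = (\<Sum>j\<in>{a<..b}. (LBINT t:{-pi..pi}. cf W t * iexp (- (t * real j)))) / (2 * pi)"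
    unfolding pmf_inversion by (simp add: sum_divide_distrib)
  also have "(\<Sum>j\<in>{a<..b}. (LBINT t:{-pi..pi}. cf W t * iexp (- (t * real j)))) =
      (LBINT t:{-pi..pi}. cf W t * (\<Sum>j\<in>{a<..b}. iexp (- (t * real j))))"
    using int unfolding set_lebesgue_integral_def set_integrable_def
    by (subst Bochner_Integration.integral_sum[symmetric]) (auto simp: scaleR_sum_right sum_distrib_left)
  finally show ?thesis .
qed

text \<open>Telescoping. The factor \<open>e\<^sup>i\<^sup>t - 1\<close> takes the place that \<open>i t\<close> has in Levy's inversion formula.\<close>

lemma iexp_interval_sum:
  assumes "a \<le> b"
  shows "(\<Sum>j\<in>{a<..b}. iexp (- (t * real j))) * (iexp t - 1) = iexp (- (t * real a)) - iexp (- (t * real b))"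
  using assms
proof (induction b rule: dec_induct)
  case (step b)
  have "{a<..Suc b} = insert (Suc b) {a<..b}" using step by auto
  moreover have "iexp (- (t * real (Suc b))) * (iexp t - 1) = iexp (- (t * real b)) - iexp (- (t * real (Suc b)))"
    by (simp add: algebra_simps exp_add[symmetric])
  ultimately show ?case using step by (simp add: distrib_right del: of_nat_Suc)
qed simp

text \<open>Since \<open>\<bar>e\<^sup>i\<^sup>t - 1\<bar> = 2 \<bar>sin (t / 2)\<bar>\<close>, the cubic remainder of the sine and \<open>\<pi> / 2 < 2\<close> suffice.\<close>

lemma norm_iexp_minus_1_ge:
  assumes "\<bar>t\<bar> \<le> pi"
  shows "\<bar>t\<bar> / 3 \<le> norm (iexp t - 1)"
proof -
  have "\<bar>sin (t / 2) - (\<Sum>m<3. sin_coeff m * (t / 2) ^ m)\<bar> \<le> inverse (fact 3) * \<bar>t / 2\<bar> ^ 3"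
    by (rule Maclaurin_sin_bound)
  moreover have "(\<Sum>m<3. sin_coeff m * (t / 2) ^ m) = t / 2"
    by (simp add: sin_coeff_def eval_nat_numeral)
  ultimately have 1: "\<bar>sin (t / 2) - t / 2\<bar> \<le> \<bar>t / 2\<bar> ^ 3 / 6"
    by (simp add: fact_numeral)
  have "\<bar>t / 2\<bar> \<le> 2" using assms pi_half_less_two by simp
  then have "\<bar>t / 2\<bar> ^ 2 * \<bar>t / 2\<bar> \<le> 2 ^ 2 * \<bar>t / 2\<bar>" by (intro mult_right_mono power_mono) auto
  then have "\<bar>t / 2\<bar> ^ 3 \<le> 4 * \<bar>t / 2\<bar>" by (simp add: power3_eq_cube power2_eq_square)
  then have "\<bar>t\<bar> / 3 \<le> 2 * \<bar>sin (t / 2)\<bar>" using 1 by (simp add: abs_if split: if_splits)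
  then show ?thesis by (simp add: dist_exp_i_1)
qed

lemma norm_power_diff_le:
  fixes z w :: "'a :: real_normed_field"
  assumes "norm z \<le> r" "norm w \<le> r"
  shows "norm (z ^ Suc n - w ^ Suc n) \<le> real (Suc n) * norm (z - w) * r ^ n"
proof (induction n)
  case (Suc n)
  have r: "0 \<le> r" using assms(1) norm_ge_zero order_trans by blast
  have "z ^ Suc (Suc n) - w ^ Suc (Suc n) = z * (z ^ Suc n - w ^ Suc n) + (z - w) * w ^ Suc n"
    by (simp add: algebra_simps)
  also have "norm \<dots> \<le> norm z * norm (z ^ Suc n - w ^ Suc n) + norm (z - w) * norm w ^ Suc n"
    by (rule order_trans[OF norm_triangle_ineq]) (simp only: norm_mult norm_power order_refl)
  also have "\<dots> \<le> r * (real (Suc n) * norm (z - w) * r ^ n) + norm (z - w) * r ^ Suc n"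
    using assms r by (intro add_mono mult_mono Suc power_mono) auto
  also have "\<dots> = real (Suc (Suc n)) * norm (z - w) * r ^ Suc n"
    by (simp add: algebra_simps)
  finally show ?case .
qed simp

lemma gaussian_integral:
  assumes "c > 0"
  shows "integrable lborel (\<lambda>t. exp (- (c * t\<^sup>2)))" "(LBINT t. exp (- (c * t\<^sup>2))) = sqrt (pi / c)"
proof -
  define s where "s = sqrt (1 / (2 * c))"
  have s: "s > 0" "s\<^sup>2 = 1 / (2 * c)" using assms by (auto simp: s_def)
  have eq: "exp (- (c * t\<^sup>2)) = sqrt (pi / c) * normal_density 0 s t" for t
    using assms by (simp add: normal_density_def s)
  show "integrable lborel (\<lambda>t. exp (- (c * t\<^sup>2)))" "(LBINT t. exp (- (c * t\<^sup>2))) = sqrt (pi / c)"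
    unfolding eq using s(1) by auto
qed

lemma integrable_lower_moments:
  fixes p :: "nat pmf"
  assumes int3: "integrable (measure_pmf p) (\<lambda>k. real k ^ 3)"
  shows "integrable (measure_pmf p) real" "integrable (measure_pmf p) (\<lambda>k. real k ^ 2)"
proof -
  have k_le: "real k \<le> 1 + real k ^ 3" "real k ^ 2 \<le> 1 + real k ^ 3" for k
    using power_increasing[of 1 3 "real k"] power_increasing[of 2 3 "real k"] by (cases k; simp)+
  have int: "integrable (measure_pmf p) (\<lambda>k. 1 + real k ^ 3)" using int3 by simp
  show "integrable (measure_pmf p) real" "integrable (measure_pmf p) (\<lambda>k. real k ^ 2)"
    by (rule Bochner_Integration.integrable_bound[OF int]; use k_le in simp)+
qed

lemma cf_moment_bound:
  fixes p :: "nat pmf"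
  assumes int3: "integrable (measure_pmf p) (\<lambda>k. real k ^ 3)"
  defines "\<mu> \<equiv> pmf_mean p"
  obtains C where "C \<ge> 0"
    "\<And>t. norm (iexp (- (t * \<mu>)) * cf p t - of_real (1 - t\<^sup>2 * pmf_var p / 2)) \<le> C * \<bar>t\<bar> ^ 3"
proof -
  let ?Y = "\<lambda>k. real k - \<mu>"
  note i1 = integrable_lower_moments(1)[OF int3] and i2 = integrable_lower_moments(2)[OF int3]
  have iY1: "integrable (measure_pmf p) ?Y" using i1 by simp
  have iY2: "integrable (measure_pmf p) (\<lambda>k. ?Y k ^ 2)" using i1 i2 by (simp add: power2_diff)
  have "(\<lambda>k. ?Y k ^ 3) = (\<lambda>k. real k ^ 3 - 3 * real k ^ 2 * \<mu> + 3 * real k * \<mu>\<^sup>2 - \<mu> ^ 3)"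
    by (auto simp: fun_eq_iff power3_eq_cube power2_eq_square algebra_simps)
  then have "integrable (measure_pmf p) (\<lambda>k. ?Y k ^ 3)" using i1 i2 int3 by simp
  then have iY3: "integrable (measure_pmf p) (\<lambda>k. \<bar>?Y k\<bar> ^ 3)"
    using integrable_abs by (fastforce simp: power_abs[symmetric])
  have mean0: "measure_pmf.expectation p ?Y = 0"
    using i1 by (simp add: \<mu>_def)
  define C where "C = measure_pmf.expectation p (\<lambda>k. \<bar>?Y k\<bar> ^ 3) / 6"
  show thesis
  proof
    show "C \<ge> 0" unfolding C_def by (intro divide_nonneg_nonneg integral_nonneg_AE) auto
    fix t
    have "norm (char (distr (measure_pmf p) borel ?Y) t - (1 - t^2 * pmf_var p / 2)) \<le>
      (t^2 / 6) * measure_pmf.expectation p (\<lambda>x. min (6 * (?Y x)^2) (\<bar>t\<bar> * \<bar>?Y x\<bar>^3))"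
      by (rule prob_space.char_approx3'[OF prob_space_measure_pmf _ iY1 iY2 mean0])
         (simp_all add: mean0[unfolded \<mu>_def] \<mu>_def del: Bochner_Integration.integral_diff)
    moreover have "measure_pmf.expectation p (\<lambda>x. min (6 * (?Y x)^2) (\<bar>t\<bar> * \<bar>?Y x\<bar>^3)) \<le>
        measure_pmf.expectation p (\<lambda>x. \<bar>t\<bar> * \<bar>?Y x\<bar>^3)"
      by (intro integral_mono integrable_min integrable_mult_right iY2 iY3) auto
    then have "(t^2 / 6) * measure_pmf.expectation p (\<lambda>x. min (6 * (?Y x)^2) (\<bar>t\<bar> * \<bar>?Y x\<bar>^3)) \<le>
        (t^2 / 6) * (\<bar>t\<bar> * (6 * C))"
      by (intro mult_left_mono) (auto simp: C_def)
    moreover have "(t^2 / 6) * (\<bar>t\<bar> * (6 * C)) = C * \<bar>t\<bar> ^ 3"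
      by (simp add: power3_eq_cube power2_eq_square)
    ultimately have "norm (char (distr (measure_pmf p) borel ?Y) t - (1 - t^2 * pmf_var p / 2)) \<le> C * \<bar>t\<bar> ^ 3"
      by linarith
    then show "norm (iexp (- (t * \<mu>)) * cf p t - of_real (1 - t\<^sup>2 * pmf_var p / 2)) \<le> C * \<bar>t\<bar> ^ 3"
      unfolding char_shifted_pmf by simp
  qed
qed

section \<open>A Berry--Esseen bound for lattice laws\<close>

definition normal_tail :: "real \<Rightarrow> real" where
  "normal_tail x = measure std_normal_distribution {x<..}"

text \<open>Levy's inversion formula for a centred normal law with standard deviation \<open>\<tau>\<close>. Gaussian decay makes
  the principal-value limit an absolutely convergent integral, which is then rescaled by \<open>\<tau>\<close>.\<close>

lemma normal_interval_inversion:
  assumes "\<alpha> \<le> \<beta>" "\<tau> > 0"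
  defines "G \<equiv> \<lambda>t. (iexp (- (t * \<alpha>)) - iexp (- (t * \<beta>))) / (\<i> * t) * of_real (exp (- ((\<tau> * t)\<^sup>2 / 2)))"
  shows "integrable lborel G"
    and "complex_of_real (measure std_normal_distribution {\<alpha> / \<tau><..\<beta> / \<tau>}) = (LBINT t. G t) / (2 * pi)"
proof -
  interpret real_distribution std_normal_distribution by (rule real_dist_normal_dist)
  define x y where "x = \<alpha> / \<tau>" and "y = \<beta> / \<tau>"
  have xy: "x \<le> y" using assms by (simp add: x_def y_def divide_right_mono)
  define g where "g u = (iexp (- (u * x)) - iexp (- (u * y))) / (\<i> * u) * char std_normal_distribution u" for u
  have meas [measurable]: "g \<in> borel_measurable borel"
    unfolding g_def by measurable
  have g_le: "norm (g u) \<le> (y - x) * exp (- (1 / 2 * u\<^sup>2))" for u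
  proof (cases "u = 0")
    case False
    have "norm ((iexp (- (u * x)) - iexp (- (u * y))) / (\<i> * u)) \<le> y - x"
      using Levy_Inversion_aux2[of "- y" "- x" u] xy False by simp
    then show ?thesis
      unfolding g_def norm_mult char_std_normal_distribution by (intro mult_mono) (use xy in auto)
  qed (use xy in \<open>simp add: g_def\<close>)
  have dom: "integrable lborel (\<lambda>u. (y - x) * exp (- (1 / 2 * u\<^sup>2)))"
    by (intro integrable_mult_right gaussian_integral) simp
  have g_int: "integrable lborel g"
    using dom by (rule Bochner_Integration.integrable_bound) (use g_le in \<open>auto intro: order_trans[OF _ abs_ge_self]\<close>)
  have atom: "prob {z} = 0" for z
  proof -
    have "emeasure std_normal_distribution {z} = 0"
      by (subst emeasure_density) (auto intro!: nn_integral_0_iff_AE[THEN iffD2] AE_I[of _ _ "{z}"] split: split_indicator)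
    then show ?thesis by (simp add: measure_def)
  qed
  have "(\<lambda>T::nat. CLBINT u=-(real T)..(real T). g u) \<longlonglongrightarrow> (LBINT u. g u)"
  proof -
    have "(\<lambda>T::nat. LBINT u. indicator {- real T<..<real T} u *\<^sub>R g u) \<longlonglongrightarrow> (LBINT u. g u)"
    proof (rule integral_dominated_convergence[OF _ _ dom])
      show "AE u in lborel. (\<lambda>T. indicator {- real T<..<real T} u *\<^sub>R g u) \<longlonglongrightarrow> g u"
      proof (rule AE_I2, rule tendsto_eventually)
        fix u
        show "\<forall>\<^sub>F T in sequentially. indicator {- real T<..<real T} u *\<^sub>R g u = g u"
          using eventually_gt_at_top[of "nat \<lceil>\<bar>u\<bar>\<rceil>"]
          by eventually_elim (auto simp: indicator_def, linarith+)
      qed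
      show "AE u in lborel. norm (indicator {- real T<..<real T} u *\<^sub>R g u) \<le> (y - x) * exp (- (1 / 2 * u\<^sup>2))" for T
        using g_le xy by (intro AE_I2) (auto simp: indicator_def)
    qed (use g_int in auto)
    then show ?thesis
      by (simp add: interval_lebesgue_integral_def set_lebesgue_integral_def einterval_eq)
  qed
  then have "(\<lambda>T::nat. 1 / (2 * pi) * (CLBINT u=-(real T)..(real T). g u)) \<longlonglongrightarrow> 1 / (2 * pi) * (LBINT u. g u)"
    by (intro tendsto_intros)
  moreover have "(\<lambda>T::nat. 1 / (2 * pi) * (CLBINT u=-(real T)..(real T). g u)) \<longlonglongrightarrow> complex_of_real (prob {x<..y})"
    using Levy_Inversion[OF xy atom atom] by (simp add: g_def)
  ultimately have "complex_of_real (prob {x<..y}) = 1 / (2 * pi) * (LBINT u. g u)"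
    using LIMSEQ_unique by blast
  then have "complex_of_real (prob {x<..y}) = (LBINT u. g u) / (2 * pi)" by simp
  have G: "\<tau> *\<^sub>R g (0 + \<tau> * t) = G t" for t
    using \<open>\<tau> > 0\<close> by (simp add: G_def g_def x_def y_def char_std_normal_distribution scaleR_conv_of_real mult_ac)
  have "(LBINT u. g u) = (LBINT t. \<tau> *\<^sub>R g (0 + \<tau> * t))"
    using \<open>\<tau> > 0\<close> by (subst lborel_integral_real_affine[of \<tau> g 0]) simp_all
  then have "(LBINT u. g u) = (LBINT t. G t)" unfolding G .
  with \<open>complex_of_real (prob {x<..y}) = (LBINT u. g u) / (2 * pi)\<close>
  show "complex_of_real (measure std_normal_distribution {\<alpha> / \<tau><..\<beta> / \<tau>}) = (LBINT t. G t) / (2 * pi)"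
    by (simp add: x_def y_def)
  have "integrable lborel (\<lambda>t. \<tau> *\<^sub>R g (0 + \<tau> * t))"
    using g_int \<open>\<tau> > 0\<close> by (intro integrable_scaleR_right lborel_integrable_real_affine) auto
  then show "integrable lborel G" unfolding G .
qed

lemma exp_minus_second_order:
  fixes u :: real
  assumes "u \<ge> 0"
  shows "\<bar>exp (- u) - (1 - u)\<bar> \<le> u\<^sup>2"
proof -
  have "exp (- u) \<le> 1 / (1 + u)"
    using exp_ge_add_one_self[of u] assms by (simp add: exp_minus field_simps)
  also have "\<dots> \<le> 1 - u + u\<^sup>2"
    using assms by (simp add: field_simps power2_eq_square)
  finally show ?thesis using exp_ge_add_one_self[of "- u"] by simp
qed

text \<open>The two properties of the centred characteristic function that drive the Berry--Esseen bound.
  Third-order closeness to the Gaussian comes from the moment expansion. Gaussian decay follows from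
  that expansion near \<open>0\<close>; on the remaining compact part of \<open>[-\<pi>, \<pi>]\<close> the modulus has a maximum
  below \<open>1\<close> by aperiodicity.\<close>

lemma cf_gaussian_comparison:
  fixes p :: "nat pmf"
  assumes int3: "integrable (measure_pmf p) (\<lambda>k. real k ^ 3)"
    and var: "pmf_var p > 0"
    and aperiodic: "\<And>t. \<bar>t\<bar> \<le> pi \<Longrightarrow> t \<noteq> 0 \<Longrightarrow> norm (cf p t) < 1"
  defines "\<psi> \<equiv> \<lambda>t. iexp (- (t * pmf_mean p)) * cf p t"
  obtains C c where "C \<ge> 0" "c > 0" "c \<le> pmf_var p / 4"
    "\<And>t. \<bar>t\<bar> \<le> pi \<Longrightarrow> norm (\<psi> t - of_real (exp (- (pmf_var p * t\<^sup>2 / 2)))) \<le> C * \<bar>t\<bar> ^ 3"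
    "\<And>t. \<bar>t\<bar> \<le> pi \<Longrightarrow> norm (\<psi> t) \<le> exp (- (c * t\<^sup>2))"
proof -
  define v where "v = pmf_var p"
  have v: "v > 0" using var by (simp add: v_def)
  obtain B where B: "B \<ge> 0" "\<And>t. norm (\<psi> t - of_real (1 - t\<^sup>2 * v / 2)) \<le> B * \<bar>t\<bar> ^ 3"
    using cf_moment_bound[OF int3] unfolding \<psi>_def v_def by blast
  have close: "norm (\<psi> t - of_real (exp (- (v * t\<^sup>2 / 2)))) \<le> (B + v\<^sup>2 * pi / 4) * \<bar>t\<bar> ^ 3" if "\<bar>t\<bar> \<le> pi" for t
  proof -
    have "\<bar>exp (- (v * t\<^sup>2 / 2)) - (1 - v * t\<^sup>2 / 2)\<bar> \<le> (v * t\<^sup>2 / 2)\<^sup>2"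
      using v by (intro exp_minus_second_order) simp
    also have "\<dots> = v\<^sup>2 / 4 * \<bar>t\<bar> * \<bar>t\<bar> ^ 3"
    proof -
      have "\<bar>t\<bar> * \<bar>t\<bar> ^ 3 = \<bar>t\<bar> ^ 4" by (simp add: eval_nat_numeral)
      then have "\<bar>t\<bar> * \<bar>t\<bar> ^ 3 = t ^ 4" by simp
      then have "v\<^sup>2 / 4 * \<bar>t\<bar> * \<bar>t\<bar> ^ 3 = v\<^sup>2 / 4 * t ^ 4" by (simp only: mult.assoc)
      moreover have "(v * t\<^sup>2 / 2)\<^sup>2 = v\<^sup>2 / 4 * t ^ 4" by (simp add: power_mult_distrib power_divide)
      ultimately show ?thesis by (simp only:)
    qed
    also have "\<dots> \<le> v\<^sup>2 / 4 * pi * \<bar>t\<bar> ^ 3"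
      using that by (intro mult_right_mono mult_left_mono) auto
    finally have "norm (of_real (1 - t\<^sup>2 * v / 2) - complex_of_real (exp (- (v * t\<^sup>2 / 2)))) \<le> v\<^sup>2 / 4 * pi * \<bar>t\<bar> ^ 3"
      unfolding of_real_diff[symmetric] norm_of_real by (simp add: abs_minus_commute mult.commute)
    then show ?thesis
      using B(2)[of t] norm_triangle_ineq[of "\<psi> t - of_real (1 - t\<^sup>2 * v / 2)" "of_real (1 - t\<^sup>2 * v / 2) - complex_of_real (exp (- (v * t\<^sup>2 / 2)))"]
      by (simp add: distrib_right)
  qed
  \<comment> \<open>Small enough for the cubic error to be at most half of the quadratic term, and for \<open>v t\<^sup>2 \<le> 1\<close>.\<close>
  define \<delta> where "\<delta> = min (v / (4 * (B + 1))) (1 / (v + 1))"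
  have \<delta>: "\<delta> > 0" using v B by (simp add: \<delta>_def)
  have near: "norm (\<psi> t) \<le> exp (- (v / 4 * t\<^sup>2))" if "\<bar>t\<bar> \<le> \<delta>" for t
  proof -
    have "\<bar>t\<bar> \<le> 1 / (v + 1)" "\<bar>t\<bar> \<le> v / (4 * (B + 1))" using that by (auto simp: \<delta>_def)
    then have t: "\<bar>t\<bar> * (v + 1) \<le> 1" "\<bar>t\<bar> * (B + 1) \<le> v / 4"
      using v B by (auto simp: field_simps)
    have "\<bar>t\<bar> * 1 \<le> \<bar>t\<bar> * (v + 1)" using v by (intro mult_left_mono) auto
    then have t1: "\<bar>t\<bar> \<le> 1" using t by simp
    have "t\<^sup>2 * v = \<bar>t\<bar> * (\<bar>t\<bar> * v)" by (simp add: power2_eq_square)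
    also have "\<dots> \<le> 1 * (\<bar>t\<bar> * (v + 1))" using t1 v by (intro mult_mono) auto
    finally have tv: "t\<^sup>2 * v \<le> 1" using t by simp
    have "B * \<bar>t\<bar> ^ 3 = t\<^sup>2 * (\<bar>t\<bar> * B)" by (simp add: power2_eq_square power3_eq_cube)
    also have "\<dots> \<le> t\<^sup>2 * (\<bar>t\<bar> * (B + 1))" by (intro mult_left_mono) auto
    also have "\<dots> \<le> t\<^sup>2 * (v / 4)" using t by (intro mult_left_mono) auto
    finally have "norm (\<psi> t) \<le> \<bar>1 - t\<^sup>2 * v / 2\<bar> + t\<^sup>2 * (v / 4)"
      using norm_triangle_sub[of "\<psi> t" "of_real (1 - t\<^sup>2 * v / 2)"] B(2)[of t] by (simp only: norm_of_real)
    also have "\<dots> = 1 + - (v / 4 * t\<^sup>2)" using tv by simp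
    also have "\<dots> \<le> exp (- (v / 4 * t\<^sup>2))" by (rule exp_ge_add_one_self)
    finally show ?thesis .
  qed
  have norm_\<psi>: "norm (\<psi> t) = norm (cf p t)" for t by (simp add: \<psi>_def norm_mult)
  obtain m where m: "0 < m" "m < 1" "\<And>t. \<delta> \<le> \<bar>t\<bar> \<Longrightarrow> \<bar>t\<bar> \<le> pi \<Longrightarrow> norm (\<psi> t) \<le> m"
  proof -
    let ?S = "{t. \<delta> \<le> \<bar>t\<bar> \<and> \<bar>t\<bar> \<le> pi}"
    have "closed ?S" by (intro closed_Collect_conj closed_Collect_le continuous_intros)
    moreover have "?S \<subseteq> {-pi..pi}" by auto
    then have "bounded ?S" by (rule bounded_subset[rotated]) simp
    ultimately have "compact ?S" by (simp add: compact_eq_bounded_closed)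
    show thesis
    proof (cases "?S = {}")
      case True
      then show thesis by (intro that[of "1 / 2"]) auto
    next
      case False
      have "continuous_on ?S (\<lambda>t. norm (cf p t))"
        by (intro continuous_intros continuous_on_cf)
      then obtain t0 where t0: "t0 \<in> ?S" "\<And>t. t \<in> ?S \<Longrightarrow> norm (cf p t) \<le> norm (cf p t0)"
        using continuous_attains_sup[OF \<open>compact ?S\<close> False] by blast
      have "norm (cf p t0) < 1" using t0(1) \<delta> by (intro aperiodic) auto
      then show thesis using t0(2)
        by (intro that[of "max (1 / 2) (norm (cf p t0))"]) (auto simp: norm_\<psi> intro: max.coboundedI2)
    qed
  qed
  define c where "c = min (v / 4) (- ln m / pi\<^sup>2)"
  have c: "c > 0" using v m by (simp add: c_def divide_neg_pos)
  have c_le: "c \<le> v / 4" "c \<le> - ln m / pi\<^sup>2"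
    unfolding c_def by (rule min.cobounded1, rule min.cobounded2)
  have "norm (\<psi> t) \<le> exp (- (c * t\<^sup>2))" if "\<bar>t\<bar> \<le> pi" for t
  proof (cases "\<bar>t\<bar> \<le> \<delta>")
    case True
    have "c * t\<^sup>2 \<le> v / 4 * t\<^sup>2" by (intro mult_right_mono c_le) simp
    then show ?thesis using near[OF True] by (meson exp_le_cancel_iff neg_le_iff_le order_trans)
  next
    case False
    have "t\<^sup>2 \<le> pi\<^sup>2" using that by (metis abs_ge_zero power2_abs power_mono)
    moreover have "0 \<le> - ln m / pi\<^sup>2" using c c_le by linarith
    ultimately have "c * t\<^sup>2 \<le> - ln m / pi\<^sup>2 * pi\<^sup>2"
      using c m by (intro mult_mono c_le) auto
    then have "ln m \<le> - (c * t\<^sup>2)" by simp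
    then have "m \<le> exp (- (c * t\<^sup>2))" using m by (metis exp_le_cancel_iff exp_ln)
    then show ?thesis using m(3)[of t] False that by simp
  qed
  with close B v c c_le show thesis
    by (intro that[of "B + v\<^sup>2 * pi / 4" c]) (auto simp: v_def)
qed

text \<open>The singularities of the two inversion kernels at the origin cancel, so replacing one by the other
  costs only a bounded factor times an integrable Gaussian.\<close>

lemma lattice_kernel_diff:
  assumes "\<bar>t\<bar> \<le> pi" "t \<noteq> 0"
  shows "norm (1 / (iexp t - 1) - 1 / (\<i> * t)) \<le> 3 / 2"
proof -
  have low: "\<bar>t\<bar> / 3 \<le> norm (iexp t - 1)" by (rule norm_iexp_minus_1_ge) fact
  then have ne: "iexp t - 1 \<noteq> 0" using assms by auto
  have "norm (iexp t - (\<Sum>k\<le>1. (\<i> * t) ^ k / fact k)) \<le> \<bar>t\<bar> ^ Suc 1 / fact (Suc 1)"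
    by (rule iexp_approx1)
  then have up: "norm (\<i> * t - (iexp t - 1)) \<le> \<bar>t\<bar> * \<bar>t\<bar> / 2"
    by (simp add: power2_eq_square norm_minus_commute algebra_simps)
  have "1 / (iexp t - 1) - 1 / (\<i> * t) = (\<i> * t - (iexp t - 1)) / ((iexp t - 1) * (\<i> * t))"
    using ne assms by (simp add: field_simps)
  also have "norm \<dots> = norm (\<i> * t - (iexp t - 1)) / (norm (iexp t - 1) * \<bar>t\<bar>)"
    by (simp add: norm_divide norm_mult)
  also have "\<dots> \<le> (\<bar>t\<bar> * \<bar>t\<bar> / 2) / (\<bar>t\<bar> / 3 * \<bar>t\<bar>)"
    using assms by (intro frac_le up mult_right_mono low mult_pos_pos) auto
  also have "\<dots> = 3 / 2" using assms by simp
  finally show ?thesis .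
qed

text \<open>Half of the Gaussian decay is spent to absorb a factor \<open>N t\<^sup>2\<close>.\<close>

lemma gaussian_absorbs_square:
  fixes u :: real
  assumes "u \<ge> 0"
  shows "u * exp (- (2 * u)) \<le> exp (- u)"
proof -
  have "u \<le> exp u" using exp_ge_add_one_self[of u] by linarith
  then have "u * exp (- (2 * u)) \<le> exp u * exp (- (2 * u))" by (intro mult_right_mono) auto
  then show ?thesis by (simp add: exp_add[symmetric])
qed

text \<open>Laws are identified through their characteristic function, so that the bound applies to sums of
  \<open>N\<close> copies of \<open>p\<close> however these sums were formed.\<close>

definition berry_esseen_bound :: "nat pmf \<Rightarrow> real \<Rightarrow> bool" where
  "berry_esseen_bound p C \<longleftrightarrow> (\<forall>W N a. N \<ge> 1 \<longrightarrow> (\<forall>t. cf W t = cf p t ^ N) \<longrightarrow>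
     \<bar>measure_pmf.prob W {a<..} - normal_tail ((real a - real N * pmf_mean p) / sqrt (real N * pmf_var p))\<bar>
       \<le> C / sqrt (real N))"

text \<open>For a bounded interval both probabilities are inverse Fourier integrals, and their integrands differ
  by at most a constant times \<open>exp (- c N t\<^sup>2 / 2)\<close>, uniformly in the interval. The integral of this
  bound is of order \<open>N\<^sup>-\<^sup>1\<^sup>/\<^sup>2\<close>. Uniformity allows the right end of the interval to go to infinity.\<close>

theorem lattice_berry_esseen:
  fixes p :: "nat pmf"
  assumes int3: "integrable (measure_pmf p) (\<lambda>k. real k ^ 3)"
    and var: "pmf_var p > 0"
    and aperiodic: "\<And>t. \<bar>t\<bar> \<le> pi \<Longrightarrow> t \<noteq> 0 \<Longrightarrow> norm (cf p t) < 1"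
  obtains C where "C \<ge> 0"
    "berry_esseen_bound p C"
proof -
  define \<mu> where "\<mu> = pmf_mean p"
  define v where "v = pmf_var p"
  define \<psi> where "\<psi> t = iexp (- (t * \<mu>)) * cf p t" for t
  have v: "v > 0" using var by (simp add: v_def)
  obtain B c where B: "B \<ge> 0" and c: "c > 0" "c \<le> v / 4"
    and close: "\<And>t. \<bar>t\<bar> \<le> pi \<Longrightarrow> norm (\<psi> t - of_real (exp (- (v * t\<^sup>2 / 2)))) \<le> B * \<bar>t\<bar> ^ 3"
    and decay: "\<And>t. \<bar>t\<bar> \<le> pi \<Longrightarrow> norm (\<psi> t) \<le> exp (- (c * t\<^sup>2))"
    using cf_gaussian_comparison[OF int3 var aperiodic] unfolding \<psi>_def v_def \<mu>_def by blast
  \<comment> \<open>The first summand bounds the difference of \<open>N\<close>-th powers on \<open>[-\<pi>, \<pi>]\<close>; the constant \<open>4\<close> covers both the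
    change of kernel there (\<open>3\<close>) and the Gaussian integrand outside \<open>[-\<pi>, \<pi>]\<close> (\<open>2\<close>).\<close>
  define K where "K = 12 * B * exp (c * pi\<^sup>2) / c + 4"
  define C where "C = K * sqrt (pi / (c / 2)) / (2 * pi)"
  have "K \<ge> 0" using B c by (simp add: K_def)
  then have "C \<ge> 0" using c by (simp add: C_def)
  have interval: "\<bar>measure_pmf.prob W {a<..b} - measure std_normal_distribution
      {(real a - real N * \<mu>) / sqrt (real N * v)<..(real b - real N * \<mu>) / sqrt (real N * v)}\<bar> \<le> C / sqrt (real N)"
    if N: "N \<ge> 1" and W: "\<And>t. cf W t = cf p t ^ N" and ab: "a \<le> b" for W and N a b :: nat
  proof -
    define \<alpha> \<beta> \<tau> where "\<alpha> = real a - real N * \<mu>" and "\<beta> = real b - real N * \<mu>" and "\<tau> = sqrt (real N * v)"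
    have \<tau>: "\<tau> > 0" "\<tau>\<^sup>2 = real N * v" using N v by (auto simp: \<tau>_def)
    define \<kappa> where "\<kappa> t = iexp (- (t * \<alpha>)) - iexp (- (t * \<beta>))" for t
    define L where "L t = indicator {-pi..pi} t *\<^sub>R (cf W t * (\<Sum>j\<in>{a<..b}. iexp (- (t * real j))))" for t
    define G where "G = (\<lambda>t. (iexp (- (t * \<alpha>)) - iexp (- (t * \<beta>))) / (\<i> * t) * of_real (exp (- ((\<tau> * t)\<^sup>2 / 2))))"
    define gauss where "gauss t = exp (- (v * t\<^sup>2 / 2))" for t
    have G: "G t = \<kappa> t * of_real (gauss t) ^ N / (\<i> * t)" for t
    proof -
      have "exp (- ((\<tau> * t)\<^sup>2 / 2)) = gauss t ^ N"
        by (simp add: gauss_def \<tau> power_mult_distrib exp_of_nat_mult[symmetric] algebra_simps)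
      then show ?thesis by (simp add: G_def \<kappa>_def)
    qed
    have \<kappa>_le: "norm (\<kappa> t) \<le> 2" for t
      unfolding \<kappa>_def by (rule order_trans[OF norm_triangle_ineq4]) simp
    have L: "L t = \<psi> t ^ N * (\<kappa> t / (iexp t - 1))" if t: "\<bar>t\<bar> \<le> pi" "t \<noteq> 0" for t
    proof -
      have ne: "iexp t - 1 \<noteq> 0" using norm_iexp_minus_1_ge[OF t(1)] t(2) by auto
      have "\<psi> t ^ N = iexp (- (t * (real N * \<mu>))) * cf W t"
        by (simp add: \<psi>_def power_mult_distrib W exp_of_nat_mult[symmetric] algebra_simps)
      moreover have "iexp (- (t * (real N * \<mu>))) * \<kappa> t = iexp (- (t * real a)) - iexp (- (t * real b))"
        by (simp add: \<kappa>_def \<alpha>_def \<beta>_def right_diff_distrib exp_add[symmetric] algebra_simps)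
      ultimately have "\<psi> t ^ N * \<kappa> t = cf W t * (iexp (- (t * real a)) - iexp (- (t * real b)))"
        by (simp add: mult_ac)
      also have "\<dots> = L t * (iexp t - 1)"
        using iexp_interval_sum[OF ab, of t] t by (simp add: L_def abs_le_iff)
      finally show ?thesis using ne by (simp add: field_simps)
    qed
    have gauss_le: "gauss t \<le> exp (- (c * t\<^sup>2))" for t
    proof -
      have "c * t\<^sup>2 \<le> v / 2 * t\<^sup>2" using c v by (intro mult_right_mono) auto
      then show ?thesis by (simp add: gauss_def)
    qed
    have exp_N: "exp (- (c * t\<^sup>2)) ^ n = exp (- (c * real n * t\<^sup>2))" for t n
      by (simp add: exp_of_nat_mult[symmetric] algebra_simps)
    define h where "h t = exp (- (c / 2 * real N * t\<^sup>2))" for t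
    have h0: "h t > 0" for t by (simp add: h_def)
    have gauss_N: "gauss t ^ N \<le> h t" for t
    proof -
      have "gauss t ^ N \<le> exp (- (c * t\<^sup>2)) ^ N"
        by (intro power_mono gauss_le) (simp add: gauss_def)
      also have "\<dots> \<le> h t" using c unfolding exp_N h_def by simp
      finally show ?thesis .
    qed
    have bound: "norm (L t - G t) \<le> K * h t" if "t \<noteq> 0" for t
    proof (cases "\<bar>t\<bar> \<le> pi")
      case False
      then have "L t = 0" by (auto simp: L_def indicator_def abs_le_iff)
      then have "norm (L t - G t) = norm (\<kappa> t) * gauss t ^ N / \<bar>t\<bar>"
        by (simp add: G norm_divide norm_mult norm_power gauss_def)
      also have "\<dots> \<le> 2 * h t / 1"
        using False pi_gt3 gauss_N[of t] \<kappa>_le[of t] h0[of t]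
        by (intro frac_le mult_mono) (auto simp: gauss_def intro: less_imp_le)
      also have "\<dots> \<le> K * h t"
        using B c h0[of t] by (simp add: K_def)
      finally show ?thesis .
    next
      case True
      have low: "\<bar>t\<bar> / 3 \<le> norm (iexp t - 1)" by (rule norm_iexp_minus_1_ge) fact
      obtain M where M: "N = Suc M" using N by (cases N) auto
      have "norm (\<psi> t ^ N - of_real (gauss t) ^ N) \<le> real N * norm (\<psi> t - of_real (gauss t)) * exp (- (c * t\<^sup>2)) ^ M"
        unfolding M by (rule norm_power_diff_le) (use decay[OF True] gauss_le[of t] in \<open>auto simp: gauss_def\<close>)
      also have "\<dots> \<le> real N * (B * \<bar>t\<bar> ^ 3) * exp (- (c * t\<^sup>2)) ^ M"
        using close[OF True] by (intro mult_right_mono mult_left_mono) (auto simp: gauss_def)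
      \<comment> \<open>One factor is missing from the \<open>N\<close>-th power since \<open>M = N - 1\<close>; it is restored at the price of \<open>exp (c \<pi>\<^sup>2)\<close>.\<close>
      also have "exp (- (c * t\<^sup>2)) ^ M = exp (c * t\<^sup>2) * exp (- (2 * (c / 2 * real N * t\<^sup>2)))"
        unfolding exp_N exp_add[symmetric] M by (simp add: algebra_simps)
      also have "real N * (B * \<bar>t\<bar> ^ 3) * (exp (c * t\<^sup>2) * exp (- (2 * (c / 2 * real N * t\<^sup>2)))) =
          (2 * B / c * exp (c * t\<^sup>2) * \<bar>t\<bar>) * ((c / 2 * real N * t\<^sup>2) * exp (- (2 * (c / 2 * real N * t\<^sup>2))))"
      proof -
        have "\<bar>t\<bar> ^ 3 = \<bar>t\<bar> * t\<^sup>2" by (simp add: power3_eq_cube power2_eq_square)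
        then show ?thesis using c by (simp add: field_simps)
      qed
      also have "\<dots> \<le> (2 * B / c * exp (c * pi\<^sup>2) * \<bar>t\<bar>) * h t"
      proof (intro mult_mono)
        have "t\<^sup>2 \<le> pi\<^sup>2" using True by (metis abs_ge_zero power2_abs power_mono)
        then show "exp (c * t\<^sup>2) \<le> exp (c * pi\<^sup>2)" using c by simp
        show "(c / 2 * real N * t\<^sup>2) * exp (- (2 * (c / 2 * real N * t\<^sup>2))) \<le> h t"
          unfolding h_def using c by (intro gaussian_absorbs_square) simp
      qed (use B c in auto)
      finally have diff: "norm (\<psi> t ^ N - of_real (gauss t) ^ N) \<le> (2 * B / c * exp (c * pi\<^sup>2) * \<bar>t\<bar>) * h t" .
      have "norm (\<kappa> t / (iexp t - 1)) \<le> 2 / (\<bar>t\<bar> / 3)"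
        unfolding norm_divide using \<kappa>_le[of t] low \<open>t \<noteq> 0\<close> by (intro frac_le) auto
      then have first: "norm ((\<psi> t ^ N - of_real (gauss t) ^ N) * (\<kappa> t / (iexp t - 1))) \<le>
          ((2 * B / c * exp (c * pi\<^sup>2) * \<bar>t\<bar>) * h t) * (2 / (\<bar>t\<bar> / 3))"
        unfolding norm_mult using diff B c h0[of t] by (intro mult_mono) (auto intro: less_imp_le)
      have second: "norm (of_real (gauss t) ^ N * \<kappa> t * (1 / (iexp t - 1) - 1 / (\<i> * t))) \<le> h t * 2 * (3 / 2)"
        unfolding norm_mult using gauss_N[of t] \<kappa>_le[of t] lattice_kernel_diff[OF True \<open>t \<noteq> 0\<close>] h0[of t]
        by (intro mult_mono) (auto simp: norm_power gauss_def intro: less_imp_le)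
      \<comment> \<open>First exchange the characteristic functions under the lattice kernel, then the kernels under the Gaussian.\<close>
      have "L t - G t = (\<psi> t ^ N - of_real (gauss t) ^ N) * (\<kappa> t / (iexp t - 1))
          + of_real (gauss t) ^ N * \<kappa> t * (1 / (iexp t - 1) - 1 / (\<i> * t))"
        unfolding L[OF True \<open>t \<noteq> 0\<close>] G by (simp add: algebra_simps add_divide_distrib diff_divide_distrib)
      also have "norm \<dots> \<le> ((2 * B / c * exp (c * pi\<^sup>2) * \<bar>t\<bar>) * h t) * (2 / (\<bar>t\<bar> / 3)) + h t * 2 * (3 / 2)"
        by (rule order_trans[OF norm_triangle_ineq add_mono[OF first second]])
      also have "\<dots> = (12 * B * exp (c * pi\<^sup>2) / c + 3) * h t"
        using \<open>t \<noteq> 0\<close> by (simp add: field_simps)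
      also have "\<dots> \<le> K * h t" using h0[of t] by (intro mult_right_mono) (auto simp: K_def)
      finally show ?thesis .
    qed
    have cN: "c / 2 * real N > 0" using c N by simp
    have h_int: "integrable lborel h" and h_val: "(LBINT t. h t) = sqrt (pi / (c / 2 * real N))"
      unfolding h_def by (rule gaussian_integral[OF cN])+
    have L_int: "integrable lborel L"
    proof -
      have "set_integrable lborel {-pi..pi} (\<lambda>t. cf W t * (\<Sum>j\<in>{a<..b}. iexp (- (t * real j))))"
        by (intro borel_integrable_atLeastAtMost' continuous_intros continuous_on_cf)
      then show ?thesis by (simp add: set_integrable_def L_def[abs_def])
    qed
    have "\<alpha> \<le> \<beta>" using ab by (simp add: \<alpha>_def \<beta>_def)
    note norm_inv = normal_interval_inversion[OF this \<tau>(1), folded G_def]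
    have "complex_of_real (measure_pmf.prob W {a<..b} - measure std_normal_distribution {\<alpha> / \<tau><..\<beta> / \<tau>}) = (LBINT t. L t - G t) / (2 * pi)"
      unfolding of_real_diff norm_inv(2) prob_interval_inversion set_lebesgue_integral_def L_def[symmetric]
      using L_int norm_inv(1) by (simp add: diff_divide_distrib)
    then have "\<bar>measure_pmf.prob W {a<..b} - measure std_normal_distribution {\<alpha> / \<tau><..\<beta> / \<tau>}\<bar> = norm ((LBINT t. L t - G t) / (2 * pi))"
      by (metis norm_of_real)
    also have "\<dots> = norm (LBINT t. L t - G t) / (2 * pi)"
      by (simp add: norm_divide)
    also have "\<dots> \<le> (LBINT t. K * h t) / (2 * pi)"
    proof (intro divide_right_mono)
      show "norm (LBINT t. L t - G t) \<le> (LBINT t. K * h t)"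
      proof (rule order_trans[OF integral_norm_bound integral_mono_AE])
        show "AE t in lborel. norm (L t - G t) \<le> K * h t"
          using AE_lborel_singleton[of "0 :: real"] by eventually_elim (rule bound)
      qed (use L_int norm_inv(1) h_int in auto)
    qed simp
    also have "\<dots> = C / sqrt (real N)"
      unfolding C_def using h_val h_int c by (simp add: real_sqrt_divide real_sqrt_mult field_simps)
    finally show ?thesis by (simp add: \<alpha>_def \<beta>_def \<tau>_def)
  qed
  have "\<bar>measure_pmf.prob W {a<..} - normal_tail ((real a - real N * pmf_mean p) / sqrt (real N * pmf_var p))\<bar> \<le> C / sqrt (real N)"
    if N: "N \<ge> 1" and W: "\<And>t. cf W t = cf p t ^ N" for W N a
  proof -
    interpret std: real_distribution std_normal_distribution by (rule real_dist_normal_dist)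
    define z where "z b = (real b - real N * \<mu>) / sqrt (real N * v)" for b
    have Nv: "sqrt (real N * v) > 0" using N v by simp
    have z_mono: "z b \<le> z b'" if "b \<le> b'" for b b'
      using that Nv by (simp add: z_def divide_right_mono)
    have "(\<lambda>b. measure_pmf.prob W {a<..b}) \<longlonglongrightarrow> measure_pmf.prob W (\<Union>b. {a<..b})"
      by (rule measure_pmf.finite_Lim_measure_incseq) (auto simp: incseq_def)
    moreover have "(\<Union>b. {a<..b}) = {a<..}" by auto
    ultimately have lim1: "(\<lambda>b. measure_pmf.prob W {a<..b}) \<longlonglongrightarrow> measure_pmf.prob W {a<..}" by simp
    have "(\<lambda>b. std.prob {z a<..z b}) \<longlonglongrightarrow> std.prob (\<Union>b. {z a<..z b})"
      by (rule std.finite_Lim_measure_incseq) (auto simp: incseq_def intro: order_trans[OF _ z_mono])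
    moreover have "(\<Union>b. {z a<..z b}) = {z a<..}"
    proof -
      have "\<exists>b. x \<le> z b" for x
      proof -
        obtain b where "x * sqrt (real N * v) + real N * \<mu> \<le> real b" using real_arch_simple by blast
        then show ?thesis using Nv by (intro exI[of _ b]) (simp add: z_def pos_le_divide_eq)
      qed
      then show ?thesis by auto
    qed
    ultimately have lim2: "(\<lambda>b. std.prob {z a<..z b}) \<longlonglongrightarrow> normal_tail (z a)"
      by (simp add: normal_tail_def)
    have "(\<lambda>b. \<bar>measure_pmf.prob W {a<..b} - std.prob {z a<..z b}\<bar>) \<longlonglongrightarrow> \<bar>measure_pmf.prob W {a<..} - normal_tail (z a)\<bar>"
      by (intro tendsto_intros lim1 lim2)
    then have "\<bar>measure_pmf.prob W {a<..} - normal_tail (z a)\<bar> \<le> C / sqrt (real N)"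
      by (rule tendsto_upperbound)
        (use interval[OF N W] in \<open>auto simp: z_def intro!: eventually_at_top_linorderI[of a]\<close>)
    then show ?thesis by (simp add: z_def \<mu>_def v_def)
  qed
  with \<open>C \<ge> 0\<close> show thesis
    by (intro that[of C]) (simp_all add: berry_esseen_bound_def)
qed

section \<open>Normal tails and the function F\<close>

lemma normal_tail_eq_integral:
  "normal_tail a = 1 / sqrt (2 * pi) * (LBINT x:{a..}. exp (- x\<^sup>2 / 2))"
proof -
  have "normal_tail a = (LINT x|std_normal_distribution. indicator {a<..} x)"
    by (simp add: normal_tail_def)
  also have "\<dots> = (LBINT x. std_normal_density x * indicator {a<..} x)"
    by (subst integral_density) auto
  also have "\<dots> = (LBINT x. 1 / sqrt (2 * pi) * (indicator {a..} x * exp (- x\<^sup>2 / 2)))"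
  proof (rule integral_cong_AE)
    show "AE x in lborel. std_normal_density x * indicator {a<..} x = 1 / sqrt (2 * pi) * (indicator {a..} x * exp (- x\<^sup>2 / 2))"
      using AE_lborel_singleton[of a]
      by eventually_elim (auto simp: std_normal_density_def indicator_def)
  qed auto
  finally show ?thesis by (simp add: set_lebesgue_integral_def)
qed

lemma F_eq_normal_tail: "F \<beta> = (\<Sum>m. normal_tail (\<beta> * sqrt (real (Suc m))) / real (Suc m))"
  unfolding F_def normal_tail_eq_integral by (simp add: mult.commute)

lemma normal_tail_nonneg: "0 \<le> normal_tail x"
  by (simp add: normal_tail_def)

lemma normal_tail_antimono: "x \<le> y \<Longrightarrow> normal_tail y \<le> normal_tail x"
proof -
  interpret real_distribution std_normal_distribution by (rule real_dist_normal_dist)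
  show "x \<le> y \<Longrightarrow> normal_tail y \<le> normal_tail x"
    unfolding normal_tail_def by (rule finite_measure_mono) auto
qed

text \<open>Chebyshev's inequality for unit variance.\<close>

lemma normal_tail_le:
  assumes "x > 0"
  shows "normal_tail x \<le> 1 / x\<^sup>2"
proof -
  interpret real_distribution std_normal_distribution by (rule real_dist_normal_dist)
  have "x\<^sup>2 * normal_tail x = (LINT u|std_normal_distribution. x\<^sup>2 * indicator {x<..} u)"
    by (simp add: normal_tail_def)
  also have "\<dots> \<le> (LINT u|std_normal_distribution. u\<^sup>2)"
  proof (rule integral_mono)
    show "integrable std_normal_distribution (\<lambda>u. x\<^sup>2 * indicator {x<..} u)"
      by (intro integrable_mult_right integrable_const_bound[of _ 1]) (auto simp: indicator_def)
    show "integrable std_normal_distribution (\<lambda>u. u\<^sup>2)" by (rule integrable_std_normal_distribution_moment)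
    show "x\<^sup>2 * indicator {x<..} u \<le> u\<^sup>2" for u
      using assms by (auto simp: indicator_def intro!: power_mono)
  qed
  also have "\<dots> = 1" using std_normal_distribution_even_moments(1)[of 1] by (simp add: fact_numeral)
  finally show ?thesis using assms by (simp add: field_simps)
qed

text \<open>On the interval the density is at most \<open>1 / x\<^sup>2\<close>. This decay, rather than a constant bound, is what
  keeps the sum over \<open>m\<close> in \<open>F_diff_le\<close> finite.\<close>

lemma normal_tail_diff_le:
  assumes "0 < x" "x \<le> y"
  shows "normal_tail x - normal_tail y \<le> (y - x) / x\<^sup>2"
proof -
  interpret real_distribution std_normal_distribution by (rule real_dist_normal_dist)
  have density_le: "std_normal_density u \<le> 1 / x\<^sup>2" if "x < u" for u
  proof -
    have "4 \<le> 2 * pi" using pi_gt3 by simp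
    then have "2 \<le> sqrt (2 * pi)" using real_le_rsqrt[of 2 "2 * pi"] by simp
    have "exp (- (u\<^sup>2 / 2)) \<le> 1 / (u\<^sup>2 / 2)"
      using exp_ge_add_one_self[of "u\<^sup>2 / 2"] that assms by (simp add: exp_minus field_simps)
    also have "\<dots> \<le> 2 / x\<^sup>2" using that assms by (simp add: frac_le power_mono)
    finally have "1 / sqrt (2 * pi) * exp (- (u\<^sup>2 / 2)) \<le> 1 / 2 * (2 / x\<^sup>2)"
      using \<open>2 \<le> sqrt (2 * pi)\<close> by (intro mult_mono frac_le) auto
    then show ?thesis by (simp add: std_normal_density_def)
  qed
  have "prob ({x<..y} \<union> {y<..}) = prob {x<..y} + prob {y<..}"
    by (rule finite_measure_Union) auto
  moreover have "{x<..y} \<union> {y<..} = {x<..}" using assms by auto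
  ultimately have "normal_tail x = prob {x<..y} + normal_tail y"
    by (simp only: normal_tail_def)
  then have "normal_tail x - normal_tail y = (LINT u|std_normal_distribution. indicator {x<..y} u)"
    by simp
  also have "\<dots> = (LBINT u. std_normal_density u * indicator {x<..y} u)"
    by (subst integral_density) auto
  also have "\<dots> \<le> (LBINT u. 1 / x\<^sup>2 * indicator {x<..y} u)"
  proof (rule integral_mono)
    show "integrable lborel (\<lambda>u. std_normal_density u * indicator {x<..y} u)"
      by (intro integrable_real_mult_indicator) auto
    show "integrable lborel (\<lambda>u. 1 / x\<^sup>2 * indicator {x<..y} u :: real)"
      by (intro integrable_mult_right integrable_real_indicator) (auto simp: assms)
    show "std_normal_density u * indicator {x<..y} u \<le> 1 / x\<^sup>2 * indicator {x<..y} u" for u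
      using density_le[of u] by (auto simp: indicator_def)
  qed
  also have "\<dots> = (y - x) / x\<^sup>2" using assms by simp
  finally show ?thesis .
qed

text \<open>The terms \<open>m\<^sup>-\<^sup>3\<^sup>/\<^sup>2\<close>, \<open>m \<ge> 1\<close>, whose convergent sum controls every error term below.\<close>

definition zeta_term :: "nat \<Rightarrow> real" where
  "zeta_term m = 1 / (real (Suc m) * sqrt (real (Suc m)))"

lemma zeta_term_nonneg: "0 \<le> zeta_term m"
  by (simp add: zeta_term_def)

lemma summable_zeta_term: "summable zeta_term"
proof -
  have "summable (\<lambda>m. real (Suc m) powr (- 3 / 2))"
    by (subst summable_Suc_iff) (simp add: summable_real_powr_iff)
  moreover have "real (Suc m) powr (- 3 / 2) = zeta_term m" for m
  proof -
    have "real (Suc m) powr (- 3 / 2) = real (Suc m) powr (- (1 + 1 / 2))" by simp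
    also have "\<dots> = zeta_term m"
      unfolding powr_minus powr_add by (simp add: zeta_term_def powr_half_sqrt inverse_eq_divide del: of_nat_Suc)
    finally show ?thesis .
  qed
  ultimately show ?thesis by simp
qed

lemma inverse_square_le_zeta_term: "1 / (real (Suc m) * real (Suc m)) \<le> zeta_term m"
proof -
  have "sqrt (real (Suc m)) \<le> real (Suc m)"
    by (rule real_le_lsqrt) (auto simp: power2_eq_square mult_le_cancel_left1)
  then show ?thesis unfolding zeta_term_def by (intro divide_left_mono mult_left_mono) auto
qed

lemma normal_tail_series:
  assumes "\<beta> > 0"
  shows "summable (\<lambda>m. normal_tail (\<beta> * sqrt (real (Suc m))) / real (Suc m))"
proof (rule summable_comparison_test'[OF summable_mult[OF summable_zeta_term, of "1 / \<beta>\<^sup>2"], of 0])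
  fix m
  have "normal_tail (\<beta> * sqrt (real (Suc m))) / real (Suc m) \<le> 1 / (\<beta> * sqrt (real (Suc m)))\<^sup>2 / real (Suc m)"
    using assms by (intro divide_right_mono normal_tail_le) auto
  also have "\<dots> = 1 / \<beta>\<^sup>2 * (1 / (real (Suc m) * real (Suc m)))"
    by (simp add: power_mult_distrib)
  also have "\<dots> \<le> 1 / \<beta>\<^sup>2 * zeta_term m"
    by (intro mult_left_mono inverse_square_le_zeta_term) simp
  finally show "norm (normal_tail (\<beta> * sqrt (real (Suc m))) / real (Suc m)) \<le> 1 / \<beta>\<^sup>2 * zeta_term m"
    by (simp add: normal_tail_nonneg)
qed

text \<open>In the \<open>m\<close>-th term the width of the interval contributes \<open>(\<beta>' - \<beta>) \<surd>m\<close>, the density \<open>1 / (\<beta>\<^sup>2 m)\<close> and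
  the weight \<open>1 / m\<close>; together they give a multiple of \<open>m\<^sup>-\<^sup>3\<^sup>/\<^sup>2\<close>.\<close>

lemma F_diff_le:
  assumes "0 < \<beta>" "\<beta> \<le> \<beta>'"
  shows "\<bar>F \<beta> - F \<beta>'\<bar> \<le> (\<beta>' - \<beta>) / \<beta>\<^sup>2 * suminf zeta_term"
proof -
  let ?f = "\<lambda>\<beta> m. normal_tail (\<beta> * sqrt (real (Suc m))) / real (Suc m)"
  have term_le: "\<bar>?f \<beta> m - ?f \<beta>' m\<bar> \<le> (\<beta>' - \<beta>) / \<beta>\<^sup>2 * zeta_term m" for m
  proof -
    let ?r = "sqrt (real (Suc m))"
    have le: "\<beta> * ?r \<le> \<beta>' * ?r" using assms by (intro mult_right_mono) auto
    have "\<bar>?f \<beta> m - ?f \<beta>' m\<bar> = (normal_tail (\<beta> * ?r) - normal_tail (\<beta>' * ?r)) / real (Suc m)"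
      using normal_tail_antimono[OF le] by (simp add: diff_divide_distrib[symmetric] del: of_nat_Suc)
    also have "\<dots> \<le> (\<beta>' * ?r - \<beta> * ?r) / (\<beta> * ?r)\<^sup>2 / real (Suc m)"
      using assms le by (intro divide_right_mono normal_tail_diff_le) auto
    also have "\<dots> = (\<beta>' - \<beta>) / \<beta>\<^sup>2 * zeta_term m"
    proof -
      have "?r > 0" "real (Suc m) = ?r * ?r" by simp_all
      then show ?thesis using assms unfolding zeta_term_def
        by (simp add: field_simps power2_eq_square del: of_nat_Suc real_sqrt_mult_self)
    qed
    finally show ?thesis .
  qed
  have "F \<beta> - F \<beta>' = (\<Sum>m. ?f \<beta> m - ?f \<beta>' m)"
    unfolding F_eq_normal_tail using assms by (intro suminf_diff normal_tail_series) auto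
  also have "\<bar>\<dots>\<bar> \<le> (\<Sum>m. (\<beta>' - \<beta>) / \<beta>\<^sup>2 * zeta_term m)"
  proof (rule order_trans[OF summable_rabs suminf_le])
    show "summable (\<lambda>m. (\<beta>' - \<beta>) / \<beta>\<^sup>2 * zeta_term m)" by (intro summable_mult summable_zeta_term)
    then show "summable (\<lambda>m. \<bar>?f \<beta> m - ?f \<beta>' m\<bar>)" "summable (\<lambda>m. \<bar>?f \<beta> m - ?f \<beta>' m\<bar>)"
      by (rule summable_comparison_test'[of _ 0]; use term_le in simp)+
  qed (rule term_le)
  also have "\<dots> = (\<beta>' - \<beta>) / \<beta>\<^sup>2 * suminf zeta_term" by (rule suminf_mult) (rule summable_zeta_term)
  finally show ?thesis .
qed

text \<open>The first term of the series alone bounds \<open>F\<close> away from zero; this turns absolute errors into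
  relative ones.\<close>

lemma F_ge:
  assumes "0 < \<beta>" "\<beta> \<le> 1"
  shows "normal_tail 1 \<le> F \<beta>"
proof -
  let ?f = "\<lambda>m. normal_tail (\<beta> * sqrt (real (Suc m))) / real (Suc m)"
  have "normal_tail 1 \<le> ?f 0" using assms by (simp add: normal_tail_antimono)
  also have "?f 0 = sum ?f {0}" by simp
  also have "\<dots> \<le> suminf ?f"
    using assms by (intro sum_le_suminf normal_tail_series) (auto simp: normal_tail_nonneg)
  finally show ?thesis by (simp add: F_eq_normal_tail)
qed

lemma normal_tail_pos: "0 < normal_tail x"
proof (rule ccontr)
  assume "\<not> 0 < normal_tail x"
  then have "normal_tail x = 0" using normal_tail_nonneg[of x] by simp
  interpret real_distribution std_normal_distribution by (rule real_dist_normal_dist)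
  have "emeasure std_normal_distribution {x<..} = 0"
    using \<open>normal_tail x = 0\<close> by (simp add: emeasure_eq_measure normal_tail_def)
  then have "{x<..} \<in> null_sets std_normal_distribution" by (simp add: null_sets_def)
  then have "AE u in lborel. u \<in> {x<..} \<longrightarrow> std_normal_density u = 0"
    by (simp add: null_sets_density_iff)
  then have "AE u in lborel. u \<notin> {x<..}"
    by eventually_elim (metis less_irrefl normal_density_pos zero_less_one)
  then have "{x<..} \<in> null_sets lborel" by (subst AE_iff_null_sets) auto
  then have "emeasure lborel {x<..} = 0" by auto
  moreover have "emeasure lborel {x<..x + 1} \<le> emeasure lborel {x<..}"
    by (intro emeasure_mono) auto
  ultimately show False by simp
qed

section \<open>The empty-system probability at a fixed capacity\<close>

text \<open>Some \<open>r > 1\<close> lies inside the radius of convergence, and \<open>k\<^sup>3 = O(r\<^sup>k)\<close>.\<close>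

lemma third_moment_of_conv_radius:
  assumes "conv_radius (pmf X) > 1"
  shows "integrable (measure_pmf X) (\<lambda>k. real k ^ 3)"
proof -
  obtain r where r: "1 < r" "ereal r < conv_radius (pmf X)"
    using ereal_dense2[OF assms] by auto
  define y where "y = root 3 r"
  have y: "y > 1" "y ^ 3 = r" using r by (simp_all add: y_def)
  have "(\<lambda>k. real k * (1 / y) ^ k) \<longlonglongrightarrow> 0"
    using powser_times_n_limit_0[of "1 / y"] y by simp
  then have "Bseq (\<lambda>k. real k * (1 / y) ^ k)"
    by (intro convergent_imp_Bseq convergentI)
  then obtain B where B: "B > 0" "\<forall>k. norm (real k * (1 / y) ^ k) \<le> B"
    by (rule BseqE)
  have cube_le: "real k ^ 3 \<le> B ^ 3 * r ^ k" for k
  proof -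
    have "real k \<le> B * y ^ k" using B(2)[rule_format, of k] y by (simp add: power_divide field_simps)
    then have "real k ^ 3 \<le> (B * y ^ k) ^ 3" by (intro power_mono) auto
    also have "\<dots> = B ^ 3 * r ^ k"
      by (simp add: power_mult_distrib y(2)[symmetric] flip: power_mult) (simp add: mult.commute)
    finally show ?thesis .
  qed
  have "summable (\<lambda>k. norm (pmf X k * r ^ k))"
    using r by (intro abs_summable_in_conv_radius) auto
  then have sm: "summable (\<lambda>k. B ^ 3 * (pmf X k * r ^ k))"
    using r by (intro summable_mult) simp
  have "summable (\<lambda>k. norm (pmf X k * real k ^ 3))"
  proof (rule summable_comparison_test'[OF sm, of 0])
    fix k
    have "pmf X k * real k ^ 3 \<le> pmf X k * (B ^ 3 * r ^ k)"
      by (intro mult_left_mono cube_le) simp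
    then show "norm (norm (pmf X k * real k ^ 3)) \<le> B ^ 3 * (pmf X k * r ^ k)"
      by (simp add: mult_ac)
  qed
  then have "integrable (count_space UNIV) (\<lambda>k. pmf X k *\<^sub>R real k ^ 3)"
    by (simp add: integrable_count_space_nat_iff)
  then show ?thesis
    by (simp add: measure_pmf_eq_density integrable_density)
qed

text \<open>On the unit circle the generating function is the characteristic function.\<close>

lemma pgf_iexp: "pgf X (iexp t) = cf X t"
proof -
  have "iexp t ^ j = iexp (t * real j)" for j
    by (simp add: exp_of_nat_mult[symmetric] mult_ac)
  then show ?thesis
    using cf_sums[of X t] by (simp add: pgf_def sums_iff)
qed

lemma pgf_one: "pgf X (1 :: real) = 1"
  using pmf_nat_sums[of X] by (simp add: pgf_def sums_iff)

text \<open>A law with zero variance is a point mass, whose characteristic function has modulus one everywhere.\<close>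

lemma variance_pos_if_aperiodic:
  fixes p :: "nat pmf"
  assumes int3: "integrable (measure_pmf p) (\<lambda>k. real k ^ 3)" and aperiodic: "norm (cf p 1) < 1"
  shows "pmf_var p > 0"
proof (rule ccontr)
  assume "\<not> pmf_var p > 0"
  moreover have "0 \<le> pmf_var p" by (intro integral_nonneg_AE) auto
  ultimately have var0: "pmf_var p = 0" by simp
  note i1 = integrable_lower_moments(1)[OF int3] and i2 = integrable_lower_moments(2)[OF int3]
  have "integrable (measure_pmf p) (\<lambda>k. (real k - pmf_mean p)\<^sup>2)"
    using i1 i2 by (simp add: power2_diff)
  then have "AE k in measure_pmf p. (real k - pmf_mean p)\<^sup>2 = 0"
    using var0 by (subst integral_nonneg_eq_0_iff_AE[symmetric]) auto
  then have "AE k in measure_pmf p. iexp (1 * real k) = iexp (pmf_mean p)"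
    by eventually_elim simp
  then have "cf p 1 = measure_pmf.expectation p (\<lambda>_. iexp (pmf_mean p))"
    unfolding cf_def by (intro integral_cong_AE) auto
  then have "norm (cf p 1) = 1" by simp
  with aperiodic show False by simp
qed

text \<open>Each term of Spitzer's series is compared with the corresponding term of \<open>F \<beta>\<close>; at \<open>a = s k\<close> the
  standardised argument in the Berry--Esseen bound is exactly \<open>\<beta> \<surd>k\<close>. The same bound, combined with
  \<open>normal_tail x \<le> 1 / x\<^sup>2\<close>, also yields the two hypotheses of Spitzer's formula: summability
  of the series, and escape of the walk \<open>T\<^sub>k - s k\<close> to minus infinity.\<close>

theorem empty_probability_gaussian:
  fixes X Q :: "nat pmf" and s N :: nat and C :: real
  assumes "C \<ge> 0"
    and berry_esseen: "berry_esseen_bound X C"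
    and var: "pmf_var X > 0" and N: "N \<ge> 1" and stable: "real N * pmf_mean X < real s"
    and stat: "stationary (congestion_kernel s N X) Q"
  defines "\<beta> \<equiv> (real s - real N * pmf_mean X) / sqrt (real N * pmf_var X)"
  shows "\<bar>ln (pmf Q 0) + F \<beta>\<bar> \<le> C / sqrt (real N) * suminf zeta_term"
proof -
  define A where "A = demand N X"
  define \<mu> v where "\<mu> = pmf_mean X" and "v = pmf_var X"
  have v: "v > 0" using var by (simp add: v_def)
  have \<mu>: "\<mu> \<ge> 0" unfolding \<mu>_def by (intro integral_nonneg_AE) auto
  have gap: "real s - real N * \<mu> > 0" using stable by (simp add: \<mu>_def)
  have \<beta>: "\<beta> > 0" using gap N var by (simp add: \<beta>_def \<mu>_def)
  have tail: "\<bar>measure (walk A k) {a<..} - normal_tail ((real a - real (N * k) * \<mu>) / sqrt (real (N * k) * v))\<bar> \<le> C / sqrt (real (N * k))"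
    if "k \<ge> 1" for k a
    using berry_esseen[unfolded berry_esseen_bound_def, rule_format, of "N * k" "walk A k" a] N that
    by (simp add: A_def cf_walk cf_demand power_mult \<mu>_def v_def)
  have arg: "(real (s * k) - real (N * k) * \<mu>) / sqrt (real (N * k) * v) = \<beta> * sqrt (real k)" for k
  proof (cases "k = 0")
    case False
    have "real (s * k) - real (N * k) * \<mu> = (real s - real N * \<mu>) * (sqrt (real k) * sqrt (real k))"
      by (simp add: algebra_simps)
    moreover have "sqrt (real (N * k) * v) = sqrt (real N * v) * sqrt (real k)"
      by (simp add: real_sqrt_mult)
    ultimately have "(real (s * k) - real (N * k) * \<mu>) / sqrt (real (N * k) * v) =
        (real s - real N * \<mu>) * (sqrt (real k) * sqrt (real k)) / (sqrt (real N * v) * sqrt (real k))"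
      by (simp only:)
    also have "\<dots> = (real s - real N * \<mu>) / sqrt (real N * v) * sqrt (real k)"
      using False by (simp del: real_sqrt_mult_self)
    finally show ?thesis by (simp add: \<beta>_def \<mu>_def v_def)
  qed simp
  define e where "e k = measure (walk A k) {s * k<..}" for k
  have e_close: "\<bar>e (Suc m) / real (Suc m) - normal_tail (\<beta> * sqrt (real (Suc m))) / real (Suc m)\<bar>
      \<le> C / sqrt (real N) * zeta_term m" for m
  proof -
    have "\<bar>e (Suc m) / real (Suc m) - normal_tail (\<beta> * sqrt (real (Suc m))) / real (Suc m)\<bar>
        = \<bar>e (Suc m) - normal_tail (\<beta> * sqrt (real (Suc m)))\<bar> / real (Suc m)"
      by (simp add: diff_divide_distrib[symmetric] del: of_nat_Suc)
    also have "\<dots> \<le> C / sqrt (real (N * Suc m)) / real (Suc m)"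
      using tail[of "Suc m" "s * Suc m"] unfolding e_def arg
      by (intro divide_right_mono) auto
    also have "\<dots> = C / sqrt (real N) * zeta_term m"
      unfolding zeta_term_def of_nat_mult real_sqrt_mult by (simp add: mult.commute del: of_nat_Suc)
    finally show ?thesis .
  qed
  have e_summable: "summable (\<lambda>m. e (Suc m) / real (Suc m))"
  proof -
    have "summable (\<lambda>m. e (Suc m) / real (Suc m) - normal_tail (\<beta> * sqrt (real (Suc m))) / real (Suc m))"
      by (rule summable_comparison_test'[OF summable_mult[OF summable_zeta_term, of "C / sqrt (real N)"], of 0]) (use e_close in simp)
    from summable_add[OF this normal_tail_series[OF \<beta>]] show ?thesis by simp
  qed
  have transient: "(\<lambda>k. measure (walk A k) {t. s * k < q + t}) \<longlonglongrightarrow> 0" for q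
  proof (rule tendsto_sandwich[OF _ _ tendsto_const])
    show "\<forall>\<^sub>F k in sequentially. measure (walk A k) {t. s * k < q + t} \<le> 4 / \<beta>\<^sup>2 * inverse (real k) + C * inverse (sqrt (real k))"
    proof -
      \<comment> \<open>From \<open>k0\<close> on, the drift has used up the initial content \<open>q\<close> twice over.\<close>
      obtain k0 :: nat where k0: "2 * real q / (real s - real N * \<mu>) \<le> real k0" using real_arch_simple by blast
      show ?thesis using eventually_ge_at_top[of "max 1 k0"]
      proof eventually_elim
        case (elim k)
        then have k: "k \<ge> 1" "real k0 \<le> real k" by auto
        have "2 * real q / (real s - real N * \<mu>) \<le> real k" using k0 k by linarith
        then have q: "real q \<le> real k * (real s - real N * \<mu>) / 2" using gap by (simp add: field_simps)
        also have "\<dots> \<le> real k * (real s - real N * \<mu>)" using gap by simp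
        also have "\<dots> \<le> real k * real s" using \<mu> by (intro mult_left_mono) auto
        finally have "q \<le> s * k" by (simp flip: of_nat_mult add: mult.commute)
        then have set_eq: "{t. s * k < q + t} = {s * k - q<..}" and real_eq: "real (s * k - q) = real (s * k) - real q"
          by (auto simp: of_nat_diff)
        have "measure (walk A k) {s * k - q<..} \<le>
            normal_tail ((real (s * k - q) - real (N * k) * \<mu>) / sqrt (real (N * k) * v)) + C / sqrt (real (N * k))"
          using tail[OF k(1), of "s * k - q"] by linarith
        also have "normal_tail ((real (s * k - q) - real (N * k) * \<mu>) / sqrt (real (N * k) * v)) \<le> normal_tail (\<beta> * sqrt (real k) / 2)"
        proof (rule normal_tail_antimono)
          have "(real (s * k) - real (N * k) * \<mu>) / 2 \<le> real (s * k - q) - real (N * k) * \<mu>"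
            unfolding real_eq using q by (simp add: field_simps)
          then have "(real (s * k) - real (N * k) * \<mu>) / 2 / sqrt (real (N * k) * v) \<le>
              (real (s * k - q) - real (N * k) * \<mu>) / sqrt (real (N * k) * v)"
            using v by (intro divide_right_mono) auto
          then show "\<beta> * sqrt (real k) / 2 \<le> (real (s * k - q) - real (N * k) * \<mu>) / sqrt (real (N * k) * v)"
            unfolding arg[symmetric] by (simp add: mult_ac)
        qed
        also have "\<dots> \<le> 1 / (\<beta> * sqrt (real k) / 2)\<^sup>2" using \<beta> k by (intro normal_tail_le) auto
        also have "\<dots> = 4 / \<beta>\<^sup>2 * inverse (real k)"
          by (simp add: power_mult_distrib power_divide field_simps)
        also have "C / sqrt (real (N * k)) \<le> C / sqrt (real k)"
          using \<open>C \<ge> 0\<close> N k by (intro divide_left_mono) auto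
        finally show ?case by (simp add: set_eq divide_inverse)
      qed
    qed
    have "(\<lambda>k. inverse (sqrt (real k))) \<longlonglongrightarrow> 0"
      by (intro tendsto_inverse_0_at_top filterlim_compose[OF sqrt_at_top] filterlim_real_sequentially)
    then have "(\<lambda>k. 4 / \<beta>\<^sup>2 * inverse (real k) + C * inverse (sqrt (real k))) \<longlonglongrightarrow> 4 / \<beta>\<^sup>2 * 0 + C * 0"
      by (intro tendsto_intros lim_inverse_n)
    then show "(\<lambda>k. 4 / \<beta>\<^sup>2 * inverse (real k) + C * inverse (sqrt (real k))) \<longlonglongrightarrow> 0" by simp
  qed simp
  have "congestion_kernel s N X = (\<lambda>q. map_pmf (\<lambda>a. q + a - s) A)"
    by (simp add: fun_eq_iff congestion_kernel_def A_def)
  then have "pmf Q 0 = exp (- (\<Sum>m. e (Suc m) / real (Suc m)))"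
    using stat e_summable transient unfolding e_def stationary_def
    by (intro stationary_empty_formula) auto
  then have "ln (pmf Q 0) + F \<beta> = - (\<Sum>m. e (Suc m) / real (Suc m) - normal_tail (\<beta> * sqrt (real (Suc m))) / real (Suc m))"
    using suminf_diff[OF e_summable normal_tail_series[OF \<beta>]] by (simp add: F_eq_normal_tail)
  also have "\<bar>\<dots>\<bar> \<le> (\<Sum>m. C / sqrt (real N) * zeta_term m)"
    unfolding abs_minus_cancel
  proof (rule order_trans[OF summable_rabs suminf_le[OF e_close]])
    show "summable (\<lambda>m. C / sqrt (real N) * zeta_term m)" by (intro summable_mult summable_zeta_term)
    then show "summable (\<lambda>m. \<bar>e (Suc m) / real (Suc m) - normal_tail (\<beta> * sqrt (real (Suc m))) / real (Suc m)\<bar>)"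
      "summable (\<lambda>m. \<bar>e (Suc m) / real (Suc m) - normal_tail (\<beta> * sqrt (real (Suc m))) / real (Suc m)\<bar>)"
      by (rule summable_comparison_test'[of _ 0]; use e_close in simp)+
  qed
  also have "\<dots> = C / sqrt (real N) * suminf zeta_term" by (rule suminf_mult) (rule summable_zeta_term)
  finally show ?thesis .
qed

section \<open>Moderate heavy traffic\<close>

text \<open>The unit circle lies inside the disc of convergence, and the generating function is \<open>1\<close> at \<open>1\<close>.\<close>

lemma aperiodic_of_dominant:
  fixes X :: "nat pmf"
  assumes radius: "conv_radius (pmf X) > 1"
    and dominant: "\<And>(r1 :: real) (z :: complex). 0 < r1 \<Longrightarrow> ereal r1 < conv_radius (pmf X) \<Longrightarrow>
          norm z = r1 \<Longrightarrow> z \<noteq> of_real r1 \<Longrightarrow> norm (pgf X z) < pgf X r1"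
    and t: "\<bar>t\<bar> \<le> pi" "t \<noteq> 0"
  shows "norm (cf X t) < 1"
proof -
  have "iexp t \<noteq> 1" using norm_iexp_minus_1_ge[OF t(1)] t(2) by auto
  then have "norm (pgf X (iexp t)) < pgf X (1 :: real)"
    using radius by (intro dominant) (auto simp: one_ereal_def)
  then show ?thesis by (simp only: pgf_iexp pgf_one)
qed

theorem theorem7:
  fixes X :: "nat pmf" and \<alpha> c C :: real
    and S :: "nat \<Rightarrow> nat" and n :: "nat \<Rightarrow> nat" and \<gamma> :: "nat \<Rightarrow> real"
    and Q :: "nat \<Rightarrow> nat pmf"
  assumes mean_pos: "pmf_mean X > 0"
    and radius: "conv_radius (pmf X) > 1"
    and dominant: "\<And>(r1 :: real) (z :: complex). 0 < r1 \<Longrightarrow> ereal r1 < conv_radius (pmf X) \<Longrightarrow>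
          norm z = r1 \<Longrightarrow> z \<noteq> of_real r1 \<Longrightarrow> norm (pgf X z) < pgf X r1"
    and alpha: "1 / 2 < \<alpha>" "\<alpha> < 1"
    and S_lim: "filterlim S at_top sequentially"
    and S_pos: "\<And>i. S i > 0"
    and n_pos: "\<And>i. n (S i) > 0"
    and stable: "\<And>i. 0 < real (n (S i)) * pmf_mean X \<and> real (n (S i)) * pmf_mean X < real (S i)"
    and exceed: "\<And>i. \<exists>j>S i. pmf (demand (n (S i)) X) j > 0"
    and scaling: "\<And>i. real (n (S i)) * pmf_mean X / real (S i)
                     = 1 - \<gamma> (S i) / real (S i) powr \<alpha>"
    and gamma_pos: "\<And>i. \<gamma> (S i) > 0"
    and gamma_bdd: "0 < c" "\<forall>\<^sub>F i in sequentially. c \<le> \<gamma> (S i) \<and> \<gamma> (S i) \<le> C"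
    and stat: "\<And>i. stationary (congestion_kernel (S i) (n (S i)) X) (Q (S i))"
  shows "\<exists>\<epsilon> :: nat \<Rightarrow> real. \<epsilon> \<in> O(\<lambda>i. real (S i) powr (\<alpha> - 1)) \<and>
           (\<forall>\<^sub>F i in sequentially.
              ln (pmf (Q (S i)) 0) = - F (d X \<alpha> (\<gamma> (S i)) (S i) * sqrt 2) * (1 + \<epsilon> i))"
proof -
  define \<mu> v where "\<mu> = pmf_mean X" and "v = pmf_var X"
  have int3: "integrable (measure_pmf X) (\<lambda>k. real k ^ 3)"
    by (rule third_moment_of_conv_radius[OF radius])
  have aperiodic: "norm (cf X t) < 1" if "\<bar>t\<bar> \<le> pi" "t \<noteq> 0" for t
    by (rule aperiodic_of_dominant[OF radius dominant that])
  have var: "pmf_var X > 0"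
    using pi_gt3 by (intro variance_pos_if_aperiodic int3 aperiodic) auto
  have pos: "\<mu> > 0" "v > 0" using mean_pos var by (auto simp: \<mu>_def v_def)
  obtain B where B: "B \<ge> 0" and berry_esseen: "berry_esseen_bound X B"
    using lattice_berry_esseen[OF int3 var aperiodic] by metis
  define Z where "Z = suminf zeta_term"
  have Z: "Z \<ge> 0" unfolding Z_def by (intro suminf_nonneg summable_zeta_term zeta_term_nonneg)
  define K where "K = (B * sqrt (2 * \<mu>) + 2 * sqrt (v / \<mu>)) * Z"
  have K: "K \<ge> 0" using B Z pos by (simp add: K_def)
  define \<beta> where "\<beta> i = d X \<alpha> (\<gamma> (S i)) (S i) * sqrt 2" for i
  have S_real: "filterlim (\<lambda>i. real (S i)) at_top sequentially"
    by (rule filterlim_compose[OF filterlim_real_sequentially S_lim])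
  \<comment> \<open>The largeness of \<open>s\<close> enters through this bound only: it gives \<open>\<rho> \<ge> 1/2\<close> and \<open>\<beta> \<le> 1\<close>.\<close>
  have small: "\<forall>\<^sub>F i in sequentially. C * real (S i) powr (- \<delta>) * M \<le> \<eta>" if "\<delta> > 0" "\<eta> > 0" for \<delta> \<eta> M
  proof -
    have "((\<lambda>x :: real. x powr (- \<delta>)) \<longlongrightarrow> 0) at_top"
      using that by (intro tendsto_neg_powr filterlim_ident) auto
    then have "(\<lambda>i. real (S i) powr (- \<delta>)) \<longlonglongrightarrow> 0"
      by (rule filterlim_compose[OF _ S_real])
    then have "(\<lambda>i. C * real (S i) powr (- \<delta>) * M) \<longlonglongrightarrow> C * 0 * M"
      by (intro tendsto_intros)
    then have "\<forall>\<^sub>F i in sequentially. C * real (S i) powr (- \<delta>) * M < \<eta>"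
      by (rule order_tendstoD(2)) (use that in simp)
    then show ?thesis by eventually_elim simp
  qed
  have main: "\<forall>\<^sub>F i in sequentially. 0 < \<beta> i \<and> \<beta> i \<le> 1 \<and>
      \<bar>ln (pmf (Q (S i)) 0) + F (\<beta> i)\<bar> \<le> K / sqrt (real (S i))"
  proof -
    have e1: "\<forall>\<^sub>F i in sequentially. C * real (S i) powr (- \<alpha>) * 1 \<le> 1 / 2"
      using alpha by (intro small) auto
    have e2: "\<forall>\<^sub>F i in sequentially. C * real (S i) powr (- (\<alpha> - 1 / 2)) * sqrt (\<mu> / v) \<le> 1"
      using alpha by (intro small) auto
    show ?thesis using gamma_bdd(2) e1 e2
    proof eventually_elim
      case (elim i)
      define s N g where "s = real (S i)" and "N = n (S i)" and "g = \<gamma> (S i)"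
      define \<rho> where "\<rho> = real N * \<mu> / s"
      have s: "s > 0" using S_pos by (simp add: s_def)
      have s1: "s \<ge> 1" using S_pos[of i] by (simp add: s_def)
      have N: "N \<ge> 1" using n_pos[of i] by (simp add: N_def)
      have \<rho>_pos: "\<rho> > 0" using N pos s by (simp add: \<rho>_def)
      have gap: "1 - \<rho> = g * s powr (- \<alpha>)"
        using scaling[of i] by (simp add: \<rho>_def s_def N_def g_def \<mu>_def powr_minus divide_inverse)
      have g: "0 < g" "g \<le> C" using gamma_pos elim by (auto simp: g_def)
      have "1 - \<rho> \<le> C * s powr (- \<alpha>)" unfolding gap using g by (intro mult_right_mono) auto
      then have \<rho>_half: "\<rho> \<ge> 1 / 2" using elim by (simp add: s_def)
      have \<rho>_lt: "\<rho> < 1" using gap g s by (smt (verit) mult_pos_pos powr_gt_zero)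
      have N_eq: "real N = \<rho> * s / \<mu>" using pos s by (simp add: \<rho>_def)
      have \<beta>_eq: "\<beta> i = (1 - \<rho>) * sqrt (s * \<mu> / v)"
      proof -
        have "\<beta> i = sqrt (s powr (1 - 2 * \<alpha>) * g\<^sup>2 * \<mu> / (2 * v) * 2)"
          by (simp only: \<beta>_def d_def s_def g_def \<mu>_def v_def real_sqrt_mult[symmetric])
        also have "s powr (1 - 2 * \<alpha>) * g\<^sup>2 * \<mu> / (2 * v) * 2 = (1 - \<rho>)\<^sup>2 * (s * \<mu> / v)"
        proof -
          have "s powr (1 - 2 * \<alpha>) = s powr (1 + (- \<alpha> + - \<alpha>))" by simp
          also have "\<dots> = s * (s powr (- \<alpha>))\<^sup>2"
            unfolding powr_add power2_eq_square using s by simp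
          finally show ?thesis unfolding gap by (simp add: power_mult_distrib)
        qed
        also have "sqrt ((1 - \<rho>)\<^sup>2 * (s * \<mu> / v)) = (1 - \<rho>) * sqrt (s * \<mu> / v)"
          unfolding real_sqrt_mult[of "(1 - \<rho>)\<^sup>2"] using \<rho>_lt by simp
        finally show ?thesis .
      qed
      have \<beta>_pos: "0 < \<beta> i" unfolding \<beta>_eq using \<rho>_lt s pos by simp
      have \<beta>_le: "\<beta> i \<le> 1"
      proof -
        have "\<beta> i = g * (s powr (- \<alpha>) * sqrt s) * sqrt (\<mu> / v)"
          unfolding \<beta>_eq gap by (simp add: real_sqrt_mult real_sqrt_divide)
        also have "s powr (- \<alpha>) * sqrt s = s powr (- (\<alpha> - 1 / 2))"
          using s by (simp add: powr_half_sqrt[symmetric] powr_add[symmetric])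
        also have "g * s powr (- (\<alpha> - 1 / 2)) * sqrt (\<mu> / v) \<le> C * s powr (- (\<alpha> - 1 / 2)) * sqrt (\<mu> / v)"
          using g pos by (intro mult_right_mono) auto
        also have "\<dots> \<le> 1" using elim by (simp add: s_def)
        finally show ?thesis .
      qed
      define b where "b = (s - real N * \<mu>) / sqrt (real N * v)"
      have b_eq: "b = \<beta> i / sqrt \<rho>"
      proof -
        have "s - real N * \<mu> = (1 - \<rho>) * s" using s by (simp add: \<rho>_def field_simps)
        moreover have "real N * v = \<rho> * (s * s) / (s * \<mu> / v)"
          unfolding N_eq using s pos by (simp add: field_simps)
        then have "sqrt (real N * v) = sqrt \<rho> * s / sqrt (s * \<mu> / v)"
          using s by (simp only: real_sqrt_divide real_sqrt_mult) simp
        ultimately show ?thesis unfolding b_def \<beta>_eq using s pos \<rho>_pos by simp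
      qed
      have sqrt_\<rho>: "\<rho> \<le> sqrt \<rho>" "sqrt \<rho> \<le> 1" "sqrt \<rho> > 0"
        using \<rho>_pos \<rho>_lt by (auto intro!: real_le_rsqrt simp: power2_eq_square mult_left_le)
      have \<beta>_b: "\<beta> i \<le> b"
        unfolding b_eq using sqrt_\<rho> \<beta>_pos by (simp add: pos_le_divide_eq mult_left_le)
      have shift: "(b - \<beta> i) / (\<beta> i)\<^sup>2 \<le> 2 * sqrt (v / \<mu>) / sqrt s"
      proof -
        have "1 / sqrt \<rho> \<le> 1 / \<rho>" using sqrt_\<rho> \<rho>_pos by (intro divide_left_mono) auto
        then have "1 / sqrt \<rho> - 1 \<le> (1 - \<rho>) / \<rho>" using \<rho>_pos by (simp add: diff_divide_distrib)
        also have "\<dots> \<le> (1 - \<rho>) / (1 / 2)"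
          using \<rho>_half \<rho>_lt by (intro divide_left_mono) auto
        finally have r: "1 / sqrt \<rho> - 1 \<le> 2 * (1 - \<rho>)" by simp
        have "(b - \<beta> i) / (\<beta> i)\<^sup>2 = (1 / sqrt \<rho> - 1) / \<beta> i"
          unfolding b_eq using \<beta>_pos by (simp add: power2_eq_square field_simps)
        also have "\<dots> \<le> 2 * (1 - \<rho>) / \<beta> i" using r \<beta>_pos by (intro divide_right_mono) auto
        also have "\<dots> = 2 / sqrt (s * \<mu> / v)" unfolding \<beta>_eq mult.commute[of 2] using \<rho>_lt
          by (intro nonzero_mult_divide_mult_cancel_left) simp
        also have "\<dots> = 2 * sqrt (v / \<mu>) / sqrt s"
          by (simp add: real_sqrt_mult real_sqrt_divide)
        finally show ?thesis .
      qed
      have "B / sqrt (real N) \<le> B * sqrt (2 * \<mu>) / sqrt s"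
      proof -
        have "s / (2 * \<mu>) \<le> real N" unfolding N_eq using \<rho>_half s pos by (simp add: field_simps)
        then have "sqrt (s / (2 * \<mu>)) \<le> sqrt (real N)" by (rule real_sqrt_le_mono)
        then have "B / sqrt (real N) \<le> B / sqrt (s / (2 * \<mu>))"
          using B s pos N by (intro divide_left_mono) auto
        also have "\<dots> = B * sqrt (2 * \<mu>) / sqrt s" by (simp add: real_sqrt_divide)
        finally show ?thesis .
      qed
      then have "B / sqrt (real N) * Z \<le> B * sqrt (2 * \<mu>) / sqrt s * Z"
        using Z by (rule mult_right_mono)
      moreover have "\<bar>ln (pmf (Q (S i)) 0) + F b\<bar> \<le> B / sqrt (real N) * Z"
        unfolding b_def s_def \<mu>_def v_def Z_def N_def
        using N stable[of i] stat[of i]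
        by (intro empty_probability_gaussian[OF B berry_esseen var]) (auto simp: N_def)
      moreover have "\<bar>F (\<beta> i) - F b\<bar> \<le> 2 * sqrt (v / \<mu>) / sqrt s * Z"
        using F_diff_le[OF \<beta>_pos \<beta>_b] mult_right_mono[OF shift Z] by (simp add: Z_def)
      moreover have "K / sqrt s = B * sqrt (2 * \<mu>) / sqrt s * Z + 2 * sqrt (v / \<mu>) / sqrt s * Z"
        by (simp add: K_def add_divide_distrib distrib_right)
      ultimately have "\<bar>ln (pmf (Q (S i)) 0) + F (\<beta> i)\<bar> \<le> K / sqrt s" by linarith
      then show ?case using \<beta>_pos \<beta>_le by (simp add: s_def)
    qed
  qed
  define \<epsilon> where "\<epsilon> i = - ln (pmf (Q (S i)) 0) / F (\<beta> i) - 1" for i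
  have F_pos: "0 < F (\<beta> i)" if "0 < \<beta> i \<and> \<beta> i \<le> 1 \<and> R" for i R
    using F_ge[of "\<beta> i"] normal_tail_pos[of 1] that by linarith
  have "\<epsilon> \<in> O(\<lambda>i. real (S i) powr (\<alpha> - 1))"
  proof (rule bigoI[of _ "K / normal_tail 1"])
    show "\<forall>\<^sub>F i in sequentially. norm (\<epsilon> i) \<le> K / normal_tail 1 * norm (real (S i) powr (\<alpha> - 1))"
      using main
    proof eventually_elim
      case (elim i)
      have "\<epsilon> i = - (ln (pmf (Q (S i)) 0) + F (\<beta> i)) / F (\<beta> i)"
        using F_pos[OF elim] by (simp add: \<epsilon>_def field_simps)
      then have "norm (\<epsilon> i) = \<bar>ln (pmf (Q (S i)) 0) + F (\<beta> i)\<bar> / F (\<beta> i)"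
        using F_pos[OF elim] by simp
      also have "\<dots> \<le> (K / sqrt (real (S i))) / normal_tail 1"
        using elim F_ge[of "\<beta> i"] normal_tail_pos[of 1] by (intro frac_le) auto
      also have "\<dots> = K / normal_tail 1 * real (S i) powr (- (1 / 2))"
      proof -
        have "real (S i) powr (- (1 / 2)) = 1 / sqrt (real (S i))"
          unfolding powr_minus_divide by (subst powr_half_sqrt) auto
        then show ?thesis by simp
      qed
      also have "\<dots> \<le> K / normal_tail 1 * real (S i) powr (\<alpha> - 1)"
        using K normal_tail_pos[of 1] alpha S_pos[of i]
        by (intro mult_left_mono powr_mono) auto
      finally show ?case by simp
    qed
  qed
  moreover have "\<forall>\<^sub>F i in sequentially. ln (pmf (Q (S i)) 0) = - F (\<beta> i) * (1 + \<epsilon> i)"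
    using main
  proof eventually_elim
    case (elim i)
    then show ?case using F_pos[OF elim] by (simp add: \<epsilon>_def)
  qed
  ultimately show ?thesis unfolding \<beta>_def by blast
qed

end
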